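(* Let $D$ be any definite $\mathcal{C}+$ action description, let $k$ be any non-negative integer, and let $F(k)$ be any multi-valued propositional formula of the signature $\sigma_k$ of $\mathit{cplus2mvpf}(D,k)$. Let $\langle B,P[t],Q[t]\rangle$ be the incremental logic program corresponding to $D$ and the query $F$, and let $\mathbf{R}_k$ be the module obtained from it (all defined in the context). Then: (1) an interpretation $I$ of $\sigma_k$ is a multi-valued stable model of $\mathit{cplus2mvpf}(D,k)\cup\{\bot\leftarrow\neg F(k)\}$ if and only if $I^{prop}$ is a stable model of $\mathbf{R}_k$; (2) conversely, an interpretation $J$ of $\sigma_k^{prop}$ is a stable model of $\mathbf{R}_k$ if and only if $J=I^{prop}$ for some multi-valued stable model $I$ of $\mathit{cplus2mvpf}(D,k)\cup\{\bot\leftarrow\neg F(k)\}$.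
   Context: **Formulas.** All formulas are built from atoms with $\bot,\wedge,\vee,\rightarrow$. We write $\neg F$ for $F\rightarrow\bot$, $\top$ for $\bot\rightarrow\bot$, and $G\leftarrow F$ for $F\rightarrow G$. A finite set of formulas is identified with the conjunction of its elements. **Multi-valued propositional formulas.** A multi-valued signature is a set $\sigma$ of symbols called constants, with a nonempty finite set $\mathrm{Dom}(c)$ of symbols, disjoint from $\sigma$, assigned to each $c\in\sigma$. An atom is an expression $c=v$ with $c\in\sigma$, $v\in \mathrm{Dom}(c)$. A formula of $\sigma$ is a propositional combination of atoms. An interpretation $I$ of $\sigma$ maps each $c\in\sigma$ to an element of $\mathrm{Dom}(c)$; $I\models c=v$ iff $I(c)=v$, and satisfaction extends to formulas by the usual truth tables. The reduct $F^I$ is obtained from $F$ by replacing each maximal subformula not satisfied by $I$ with $\bot$. $I$ is a multi-valued stable model of $F$ if $I$ is the unique interpretation of $\sigma$ satisfying $F^I$. **Action descriptions.** The signature of a $\mathcal{C}+$ description is a multi-valued signature partitioned into fluent constants and action constants; fluent constants are further partitioned into simple and statically determined. A fluent formula is a formula all of whose constants are fluent constants. An action formula is a formula containing at least one action constant and no fluent constants. A static law is an expression "**caused** $F$ **if** $G$" with $F,G$ fluent formulas. An action dynamic law is an expression "**caused** $F$ **if** $G$" with $F$ an action formula and $G$ a formula. A fluent dynamic law is an expression "**caused** $F$ **if** $G$ **after** $H$" with $F,G$ fluent formulas and $H$ a formula, where $F$ contains no statically determined constants. An action description is a finite set of such laws. It is definite if the $F$ in every law is an atom or $\bot$. **The theory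 $\mathit{cplus2mvpf}(D,m)$.** Its signature $\sigma_m$ consists of the pairs $i{:}c$ where either $i\in\{0,\dots,m\}$ and $c$ is a fluent constant, or $i\in\{0,\dots,m-1\}$ and $c$ is an action constant; $\mathrm{Dom}(i{:}c)=\mathrm{Dom}(c)$. For a formula $F$, $i{:}F$ is the result of inserting $i{:}$ in front of every occurrence of every constant in $F$. The rules are: - $i{:}F\leftarrow\neg\neg(i{:}G)$ for every static law in $D$ and $i\in\{0,\dots,m\}$, and for every action dynamic law in $D$ and $i\in\{0,\dots,m-1\}$; - $i{:}F\leftarrow\neg\neg(i{:}G)\wedge((i-1){:}H)$ for every fluent dynamic law in $D$ and $i\in\{1,\dots,m\}$; - $0{:}c=v\leftarrow\neg\neg(0{:}c=v)$ for every simple fluent constant $c$ and $v\in\mathrm{Dom}(c)$. **Passing to propositional formulas.** For a multi-valued signature $\sigma$, $\sigma^{prop}$ is the propositional signature with atoms $c(v)$ for $c\in\sigma$, $v\in\mathrm{Dom}(c)$. $F^{prop}$ is obtained from $F$ by replacing each atom $c=v$ with $c(v)$. For an interpretation $I$ of $\sigma$, $I^{prop}$ is the interpretation of $\sigma^{prop}$ with $I^{prop}\models c(v)$ iff $I\models c=v$. $\mathit{UEC}(c)$ is the conjunction of $\bot\leftarrow(c(v)\wedge c(v'))$ for all $v\ne v'$ in $\mathrm{Dom}(c)$ and of $\bot\leftarrow\neg\bigvee_{v\in\mathrm{Dom}(c)}c(v)$; $i{:}\mathit{UEC}(c)$ is the same formula for the constant $i{:}c$. Propositional interpretations are identified with the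 set of atoms they make true. **The incremental program $\langle B,P[t],Q[t]\rangle$.** - $B$ consists of: $0{:}\mathit{UEC}(f)$ for every fluent constant $f$; $0{:}c(v)\leftarrow\neg\neg(0{:}c(v))$ for every simple fluent constant $c$ and $v\in \mathrm{Dom}(c)$; $0{:}F^{prop}\leftarrow\neg\neg(0{:}G^{prop})$ for every static law in $D$. - $P[t]$ ($t\ge1$) consists of: $t{:}\mathit{UEC}(f)$ for every fluent constant $f$; $(t-1){:}\mathit{UEC}(a)$ for every action constant $a$; $t{:}F^{prop}\leftarrow\neg\neg(t{:}G^{prop})$ for every static law; $(t-1){:}F^{prop}\leftarrow\neg\neg((t-1){:}G^{prop})$ for every action dynamic law; $t{:}F^{prop}\leftarrow\neg\neg(t{:}G^{prop})\wedge((t-1){:}H^{prop})$ for every fluent dynamic law. - $Q[t]$ is $\bot\leftarrow\neg(F(t))^{prop}$, where $F(t)$ is the query. **Modules.** An occurrence of an atom or subformula in a formula is positive if it lies in the antecedents of an even number of implications, and strictly positive if it lies in the antecedent of no implication. A formula is negative on a set $O$ of atoms if no atom of $O$ has a strictly positive occurrence in it. A module is a triple $(F,\mathcal{I},\mathcal{O})$ where $F$ is a propositional formula and $\mathcal{I}$ (input), $\mathcal{O}$ (output) are disjoint sets of atoms such that all atoms of $F$ are in $\mathcal{I}\cup\mathcal{O}$; $\mathit{Out}(F,\mathcal{I},\mathcal{O})=\mathcal{O}$. A set of atoms $J\subseteq\mathcal{I}\cup\mathcal{O}$ is a stable model of the module if $J\models F$ and there is no $J'\subsetneq J$ with $J\setminus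 J'\subseteq\mathcal{O}$ and $J'\models F^J$, where $F^J$ is obtained from $F$ by replacing each maximal subformula not satisfied by $J$ with $\bot$. An interpretation of $\sigma_k^{prop}$ is a stable model of $\mathbf{R}_k$ if its set of true atoms is one (so atoms outside the input and output sets are false). The dependency graph $DG[F;\mathcal{O}]$ has vertex set $\mathcal{O}$ and an edge from $p$ to $q$ if, for some strictly positive occurrence of an implication $G\rightarrow H$ in $F$, $p$ has a strictly positive occurrence in $H$ and $q$ has a positive occurrence in $G$ not belonging to any subformula of $G$ that is negative on $\mathcal{O}$. Modules $(F_1,\mathcal{I}_1,\mathcal{O}_1)$ and $(F_2,\mathcal{I}_2,\mathcal{O}_2)$ are joinable if $\mathcal{O}_1\cap\mathcal{O}_2=\emptyset$, each strongly connected component of $DG[F_1\wedge F_2;\mathcal{O}_1\cup\mathcal{O}_2]$ is contained in $\mathcal{O}_1$ or in $\mathcal{O}_2$, $F_1$ is negative on $\mathcal{O}_2$, and $F_2$ is negative on $\mathcal{O}_1$. The join of joinable modules is $$(F_1,\mathcal{I}_1,\mathcal{O}_1)\sqcup(F_2,\mathcal{I}_2,\mathcal{O}_2)=(F_1\wedge F_2,\ (\mathcal{I}_1\cup\mathcal{I}_2)\setminus(\mathcal{O}_1\cup\mathcal{O}_2),\ \mathcal{O}_1\cup\mathcal{O}_2).$$ **Instantiation $\mathit{FM}$.** For a formula $F$ and a set $X$ of atoms, $F|_X$ is obtained from $F$ by replacing every atom not in $X$ with $\bot$ and then simplifying exhaustively by the rules: $\neg\bot\mapsto\top$, $\neg\top\mapsto\bot$,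 $\bot\wedge G\mapsto\bot$, $\top\wedge G\mapsto G$, $\bot\vee G\mapsto G$, $\top\vee G\mapsto\top$ (and symmetrically), $\bot\rightarrow G\mapsto\top$, $G\rightarrow\top\mapsto\top$, $\top\rightarrow G\mapsto G$. Let $\mathit{head}(F)$ be the set of atoms with a strictly positive occurrence in $F$. For a set $\mathcal{I}$ of atoms, $$\mathit{FM}(F,\mathcal{I})=(F|_{\mathcal{I}\cup\mathcal{O}},\ \mathcal{I},\ \mathcal{O}),\qquad \mathcal{O}=\mathit{head}(F|_{\mathcal{I}\cup \mathit{head}(F)}).$$ **The module $\mathbf{R}_k$.** $$\mathbf{P}_0=\mathit{FM}(B,\emptyset),\qquad \mathbf{P}_i=\mathbf{P}_{i-1}\sqcup \mathit{FM}(P[i],\mathit{Out}(\mathbf{P}_{i-1}))\ (1\le i\le k),\qquad \mathbf{R}_k=\mathbf{P}_k\sqcup \mathit{FM}(Q[k],\mathit{Out}(\mathbf{P}_k)).$$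
   Formalization: The formal theorem assumes that Dom(c) has at least two elements for every constant c; with a one-element domain the claim fails, e.g. for a single statically determined fluent, D empty, k = 0 and F(0) = ⊤. *)

theory Defs
  imports Main "HOL-Library.FuncSet"
begin

section \<open>Formulas\<close>

datatype (atoms: 'a) form =
    Atom 'a
  | Bot
  | And "'a form" "'a form"
  | Or "'a form" "'a form"
  | Imp "'a form" "'a form"
  for map: map_form

abbreviation Neg :: "'a form \<Rightarrow> 'a form" where
  "Neg F \<equiv> Imp F Bot"

abbreviation Top :: "'a form" where
  "Top \<equiv> Imp Bot Bot"

text \<open>
  Finite sets of formulas stand for conjunctions (disjunctions). The order in which the
  members are listed is arbitrary, and is fixed here by choice; the empty conjunction is
  \<open>Top\<close> and the empty disjunction is \<open>Bot\<close>.
\<close>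

definition list_of :: "'b set \<Rightarrow> 'b list" where
  "list_of A = (SOME xs. set xs = A \<and> distinct xs)"

definition Conj :: "'a form set \<Rightarrow> 'a form" where
  "Conj A = foldr And (list_of A) Top"

definition Disj :: "'a form set \<Rightarrow> 'a form" where
  "Disj A = foldr Or (list_of A) Bot"

text \<open>Satisfaction and reduct, relative to a truth assignment \<open>T\<close> to the atoms.\<close>

primrec sat :: "('a \<Rightarrow> bool) \<Rightarrow> 'a form \<Rightarrow> bool" where
  "sat T (Atom a) = T a"
| "sat T Bot = False"
| "sat T (And F G) = (sat T F \<and> sat T G)"
| "sat T (Or F G) = (sat T F \<or> sat T G)"
| "sat T (Imp F G) = (sat T F \<longrightarrow> sat T G)"

primrec reduct :: "('a \<Rightarrow> bool) \<Rightarrow> 'a form \<Rightarrow> 'a form" where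
  "reduct T (Atom a) = (if sat T (Atom a) then Atom a else Bot)"
| "reduct T Bot = Bot"
| "reduct T (And F G) = (if sat T (And F G) then And (reduct T F) (reduct T G) else Bot)"
| "reduct T (Or F G) = (if sat T (Or F G) then Or (reduct T F) (reduct T G) else Bot)"
| "reduct T (Imp F G) = (if sat T (Imp F G) then Imp (reduct T F) (reduct T G) else Bot)"


section \<open>Multi-valued formulas and their stable models\<close>

text \<open>
  A multi-valued signature is given by a set \<open>\<sigma>\<close> of constants and a map \<open>dm\<close> assigning a domain
  to each constant. Constants and values have different types, so domains are disjoint
  from \<open>\<sigma>\<close>. Interpretations are extensional functions, so that they are determined by their
  values on \<open>\<sigma>\<close>.
\<close>

datatype ('c, 'v) mvatom = MVEq 'c 'v

definition mv_signature :: "'c set \<Rightarrow> ('c \<Rightarrow> 'v set) \<Rightarrow> bool" where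
  "mv_signature \<sigma> dm \<longleftrightarrow> (\<forall>c\<in>\<sigma>. finite (dm c) \<and> dm c \<noteq> {})"

definition mv_formula :: "'c set \<Rightarrow> ('c \<Rightarrow> 'v set) \<Rightarrow> ('c, 'v) mvatom form \<Rightarrow> bool" where
  "mv_formula \<sigma> dm F \<longleftrightarrow> (\<forall>c v. MVEq c v \<in> atoms F \<longrightarrow> c \<in> \<sigma> \<and> v \<in> dm c)"

definition consts_of :: "('c, 'v) mvatom form \<Rightarrow> 'c set" where
  "consts_of F = {c. \<exists>v. MVEq c v \<in> atoms F}"

definition mv_interps :: "'c set \<Rightarrow> ('c \<Rightarrow> 'v set) \<Rightarrow> ('c \<Rightarrow> 'v) set" where
  "mv_interps \<sigma> dm = (\<Pi>\<^sub>E c\<in>\<sigma>. dm c)"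

primrec mv_true :: "('c \<Rightarrow> 'v) \<Rightarrow> ('c, 'v) mvatom \<Rightarrow> bool" where
  "mv_true I (MVEq c v) \<longleftrightarrow> I c = v"

definition mv_stable ::
    "'c set \<Rightarrow> ('c \<Rightarrow> 'v set) \<Rightarrow> ('c, 'v) mvatom form \<Rightarrow> ('c \<Rightarrow> 'v) \<Rightarrow> bool" where
  "mv_stable \<sigma> dm F I \<longleftrightarrow>
     I \<in> mv_interps \<sigma> dm \<and>
     (\<forall>J\<in>mv_interps \<sigma> dm. sat (mv_true J) (reduct (mv_true I) F) \<longleftrightarrow> J = I)"


section \<open>Action descriptions\<close>

record ('c, 'v) cplus_sig =
  simple :: "'c set"
  statdet :: "'c set"
  actions :: "'c set"
  Dom :: "'c \<Rightarrow> 'v set"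

definition fluents :: "('c, 'v) cplus_sig \<Rightarrow> 'c set" where
  "fluents S = simple S \<union> statdet S"

definition constants :: "('c, 'v) cplus_sig \<Rightarrow> 'c set" where
  "constants S = fluents S \<union> actions S"

text \<open>
  Finiteness of the set of constants is what makes the theories below, which contain rules
  for all constants, finite and hence formulas.
\<close>

definition cplus_signature :: "('c, 'v) cplus_sig \<Rightarrow> bool" where
  "cplus_signature S \<longleftrightarrow>
     mv_signature (constants S) (Dom S) \<and> finite (constants S) \<and>
     fluents S \<inter> actions S = {} \<and> simple S \<inter> statdet S = {}"

text \<open>
  \<open>Static F G\<close> and \<open>ActionDyn F G\<close> are \<open>caused F if G\<close>;
  \<open>FluentDyn F G H\<close> is \<open>caused F if G after H\<close>.
\<close>

datatype ('c, 'v) law =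
    Static "('c, 'v) mvatom form" "('c, 'v) mvatom form"
  | ActionDyn "('c, 'v) mvatom form" "('c, 'v) mvatom form"
  | FluentDyn "('c, 'v) mvatom form" "('c, 'v) mvatom form" "('c, 'v) mvatom form"

definition cplus_formula :: "('c, 'v) cplus_sig \<Rightarrow> ('c, 'v) mvatom form \<Rightarrow> bool" where
  "cplus_formula S F \<longleftrightarrow> mv_formula (constants S) (Dom S) F"

definition fluent_formula :: "('c, 'v) cplus_sig \<Rightarrow> ('c, 'v) mvatom form \<Rightarrow> bool" where
  "fluent_formula S F \<longleftrightarrow> cplus_formula S F \<and> consts_of F \<subseteq> fluents S"

definition action_formula :: "('c, 'v) cplus_sig \<Rightarrow> ('c, 'v) mvatom form \<Rightarrow> bool" where
  "action_formula S F \<longleftrightarrow>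
     cplus_formula S F \<and> consts_of F \<inter> actions S \<noteq> {} \<and> consts_of F \<inter> fluents S = {}"

primrec law_of :: "('c, 'v) cplus_sig \<Rightarrow> ('c, 'v) law \<Rightarrow> bool" where
  "law_of S (Static F G) \<longleftrightarrow> fluent_formula S F \<and> fluent_formula S G"
| "law_of S (ActionDyn F G) \<longleftrightarrow> action_formula S F \<and> cplus_formula S G"
| "law_of S (FluentDyn F G H) \<longleftrightarrow>
     fluent_formula S F \<and> fluent_formula S G \<and> cplus_formula S H \<and>
     consts_of F \<inter> statdet S = {}"

definition action_description :: "('c, 'v) cplus_sig \<Rightarrow> ('c, 'v) law set \<Rightarrow> bool" where
  "action_description S D \<longleftrightarrow> cplus_signature S \<and> finite D \<and> (\<forall>l\<in>D. law_of S l)"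

primrec law_head :: "('c, 'v) law \<Rightarrow> ('c, 'v) mvatom form" where
  "law_head (Static F G) = F"
| "law_head (ActionDyn F G) = F"
| "law_head (FluentDyn F G H) = F"

definition definite :: "('c, 'v) law set \<Rightarrow> bool" where
  "definite D \<longleftrightarrow> (\<forall>l\<in>D. law_head l = Bot \<or> (\<exists>a. law_head l = Atom a))"


section \<open>The multi-valued theory of an action description\<close>

text \<open>The constant \<open>i:c\<close> is the pair \<open>(i, c)\<close>; \<open>stamp i F\<close> is \<open>i:F\<close>.\<close>

definition sigma_at :: "('c, 'v) cplus_sig \<Rightarrow> nat \<Rightarrow> (nat \<times> 'c) set" where
  "sigma_at S m = {0..m} \<times> fluents S \<union> {0..<m} \<times> actions S"

definition timed_Dom :: "('c, 'v) cplus_sig \<Rightarrow> nat \<times> 'c \<Rightarrow> 'v set" where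
  "timed_Dom S ic = Dom S (snd ic)"

definition stamp :: "nat \<Rightarrow> ('c, 'v) mvatom form \<Rightarrow> (nat \<times> 'c, 'v) mvatom form" where
  "stamp i = map_form (map_mvatom (Pair i) id)"

definition cplus2mvpf ::
    "('c, 'v) cplus_sig \<Rightarrow> ('c, 'v) law set \<Rightarrow> nat \<Rightarrow> (nat \<times> 'c, 'v) mvatom form set" where
  "cplus2mvpf S D m =
     {Imp (Neg (Neg (stamp i G))) (stamp i F) | i F G. Static F G \<in> D \<and> i \<in> {0..m}} \<union>
     {Imp (Neg (Neg (stamp i G))) (stamp i F) | i F G. ActionDyn F G \<in> D \<and> i \<in> {0..<m}} \<union>
     {Imp (And (Neg (Neg (stamp i G))) (stamp (i - 1) H)) (stamp i F) | i F G H.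
        FluentDyn F G H \<in> D \<and> i \<in> {1..m}} \<union>
     {Imp (Neg (Neg (Atom (MVEq (0, c) v)))) (Atom (MVEq (0, c) v)) | c v.
        c \<in> simple S \<and> v \<in> Dom S c}"


section \<open>Passing to propositional formulas\<close>

text \<open>\<open>PVal c v\<close> is the propositional atom \<open>c(v)\<close>.\<close>

datatype ('c, 'v) patom = PVal 'c 'v

primrec patom_of :: "('c, 'v) mvatom \<Rightarrow> ('c, 'v) patom" where
  "patom_of (MVEq c v) = PVal c v"

definition prop_form :: "('c, 'v) mvatom form \<Rightarrow> ('c, 'v) patom form" where
  "prop_form = map_form patom_of"

definition prop_atoms :: "'c set \<Rightarrow> ('c \<Rightarrow> 'v set) \<Rightarrow> ('c, 'v) patom set" where
  "prop_atoms \<sigma> dm = {PVal c v | c v. c \<in> \<sigma> \<and> v \<in> dm c}"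

definition prop_interp ::
    "'c set \<Rightarrow> ('c \<Rightarrow> 'v set) \<Rightarrow> ('c \<Rightarrow> 'v) \<Rightarrow> ('c, 'v) patom set" where
  "prop_interp \<sigma> dm I = {PVal c v | c v. c \<in> \<sigma> \<and> v \<in> dm c \<and> mv_true I (MVEq c v)}"

definition UEC :: "('c \<Rightarrow> 'v set) \<Rightarrow> 'c \<Rightarrow> ('c, 'v) patom form" where
  "UEC dm c = Conj (
     {Imp (And (Atom (PVal c v)) (Atom (PVal c v'))) Bot | v v'.
        v \<in> dm c \<and> v' \<in> dm c \<and> v \<noteq> v'} \<union>
     {Imp (Neg (Disj {Atom (PVal c v) | v. v \<in> dm c})) Bot})"


section \<open>The incremental program\<close>

definition prog_B ::
    "('c, 'v) cplus_sig \<Rightarrow> ('c, 'v) law set \<Rightarrow> (nat \<times> 'c, 'v) patom form" where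
  "prog_B S D = Conj (
     {UEC (timed_Dom S) (0, f) | f. f \<in> fluents S} \<union>
     {Imp (Neg (Neg (Atom (PVal (0, c) v)))) (Atom (PVal (0, c) v)) | c v.
        c \<in> simple S \<and> v \<in> Dom S c} \<union>
     {Imp (Neg (Neg (prop_form (stamp 0 G)))) (prop_form (stamp 0 F)) | F G.
        Static F G \<in> D})"

definition prog_P ::
    "('c, 'v) cplus_sig \<Rightarrow> ('c, 'v) law set \<Rightarrow> nat \<Rightarrow> (nat \<times> 'c, 'v) patom form" where
  "prog_P S D t = Conj (
     {UEC (timed_Dom S) (t, f) | f. f \<in> fluents S} \<union>
     {UEC (timed_Dom S) (t - 1, a) | a. a \<in> actions S} \<union>
     {Imp (Neg (Neg (prop_form (stamp t G)))) (prop_form (stamp t F)) | F G.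
        Static F G \<in> D} \<union>
     {Imp (Neg (Neg (prop_form (stamp (t - 1) G)))) (prop_form (stamp (t - 1) F)) | F G.
        ActionDyn F G \<in> D} \<union>
     {Imp (And (Neg (Neg (prop_form (stamp t G)))) (prop_form (stamp (t - 1) H)))
          (prop_form (stamp t F)) | F G H.
        FluentDyn F G H \<in> D})"

definition prog_Q ::
    "(nat \<Rightarrow> (nat \<times> 'c, 'v) mvatom form) \<Rightarrow> nat \<Rightarrow> (nat \<times> 'c, 'v) patom form" where
  "prog_Q Q t = Imp (Neg (prop_form (Q t))) Bot"


section \<open>Modules\<close>

text \<open>\<open>head F\<close> collects the atoms with a strictly positive occurrence in \<open>F\<close>.\<close>

primrec head :: "'a form \<Rightarrow> 'a set" where
  "head (Atom a) = {a}"
| "head Bot = {}"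
| "head (And F G) = head F \<union> head G"
| "head (Or F G) = head F \<union> head G"
| "head (Imp F G) = head G"

definition negative_on :: "'a set \<Rightarrow> 'a form \<Rightarrow> bool" where
  "negative_on Out F \<longleftrightarrow> head F \<inter> Out = {}"

text \<open>The pairs \<open>(G, H)\<close> such that \<open>Imp G H\<close> has a strictly positive occurrence in the formula.\<close>

primrec sp_imps :: "'a form \<Rightarrow> ('a form \<times> 'a form) set" where
  "sp_imps (Atom a) = {}"
| "sp_imps Bot = {}"
| "sp_imps (And F G) = sp_imps F \<union> sp_imps G"
| "sp_imps (Or F G) = sp_imps F \<union> sp_imps G"
| "sp_imps (Imp F G) = insert (F, G) (sp_imps G)"

text \<open>
  The atoms with an occurrence in \<open>F\<close> that does not belong to any subformula of \<open>F\<close> negative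
  on \<open>Out\<close> and that is positive if \<open>pol\<close> holds, and not positive (in an odd number of
  antecedents) otherwise. Note that every atom outside \<open>Out\<close> is itself a subformula negative
  on \<open>Out\<close>.
\<close>

primrec nonneg_occ :: "'a set \<Rightarrow> bool \<Rightarrow> 'a form \<Rightarrow> 'a set" where
  "nonneg_occ Out pol (Atom a) =
     (if negative_on Out (Atom a) then {} else if pol then {a} else {})"
| "nonneg_occ Out pol Bot = {}"
| "nonneg_occ Out pol (And F G) =
     (if negative_on Out (And F G) then {} else nonneg_occ Out pol F \<union> nonneg_occ Out pol G)"
| "nonneg_occ Out pol (Or F G) =
     (if negative_on Out (Or F G) then {} else nonneg_occ Out pol F \<union> nonneg_occ Out pol G)"
| "nonneg_occ Out pol (Imp F G) =
     (if negative_on Out (Imp F G) then {}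
      else nonneg_occ Out (\<not> pol) F \<union> nonneg_occ Out pol G)"

definition dep_edges :: "'a form \<Rightarrow> 'a set \<Rightarrow> ('a \<times> 'a) set" where
  "dep_edges F Out = {(p, q). p \<in> Out \<and> q \<in> Out \<and>
     (\<exists>(G, H)\<in>sp_imps F. p \<in> head H \<and> q \<in> nonneg_occ Out True G)}"

text \<open>Vertex sets of the strongly connected components, as classes of mutual reachability.\<close>

definition sccs :: "'a set \<Rightarrow> ('a \<times> 'a) set \<Rightarrow> 'a set set" where
  "sccs V E = V // {(p, q). p \<in> V \<and> q \<in> V \<and> (p, q) \<in> E\<^sup>* \<and> (q, p) \<in> E\<^sup>*}"

record 'a lp_module =
  mform :: "'a form"
  minp :: "'a set"
  mout :: "'a set"

definition is_module :: "'a lp_module \<Rightarrow> bool" where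
  "is_module M \<longleftrightarrow> minp M \<inter> mout M = {} \<and> atoms (mform M) \<subseteq> minp M \<union> mout M"

definition module_stable :: "'a lp_module \<Rightarrow> 'a set \<Rightarrow> bool" where
  "module_stable M J \<longleftrightarrow>
     J \<subseteq> minp M \<union> mout M \<and> sat (\<lambda>a. a \<in> J) (mform M) \<and>
     \<not> (\<exists>J'. J' \<subset> J \<and> J - J' \<subseteq> mout M \<and>
          sat (\<lambda>a. a \<in> J') (reduct (\<lambda>a. a \<in> J) (mform M)))"

definition joinable :: "'a lp_module \<Rightarrow> 'a lp_module \<Rightarrow> bool" where
  "joinable M1 M2 \<longleftrightarrow>
     is_module M1 \<and> is_module M2 \<and>
     mout M1 \<inter> mout M2 = {} \<and>
     (\<forall>C\<in>sccs (mout M1 \<union> mout M2)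
            (dep_edges (And (mform M1) (mform M2)) (mout M1 \<union> mout M2)).
        C \<subseteq> mout M1 \<or> C \<subseteq> mout M2) \<and>
     negative_on (mout M2) (mform M1) \<and> negative_on (mout M1) (mform M2)"

text \<open>The join is a partial operation; \<open>None\<close> means that it is undefined.\<close>

definition join :: "'a lp_module \<Rightarrow> 'a lp_module \<Rightarrow> 'a lp_module option" where
  "join M1 M2 =
     (if joinable M1 M2
      then Some \<lparr>mform = And (mform M1) (mform M2),
                 minp = (minp M1 \<union> minp M2) - (mout M1 \<union> mout M2),
                 mout = mout M1 \<union> mout M2\<rparr>
      else None)"


section \<open>Instantiation and the module of the incremental program\<close>

text \<open>
  One bottom-up pass with the following constructors yields the (unique) normal form with
  respect to the simplification rules. The rules for \<open>Neg\<close> are instances of those for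
  \<open>Imp\<close>, since \<open>Neg F\<close> is \<open>Imp F Bot\<close> and \<open>Top\<close> is \<open>Imp Bot Bot\<close>.
\<close>

definition simp_And :: "'a form \<Rightarrow> 'a form \<Rightarrow> 'a form" where
  "simp_And F G =
     (if F = Bot \<or> G = Bot then Bot else if F = Top then G else if G = Top then F
      else And F G)"

definition simp_Or :: "'a form \<Rightarrow> 'a form \<Rightarrow> 'a form" where
  "simp_Or F G =
     (if F = Top \<or> G = Top then Top else if F = Bot then G else if G = Bot then F
      else Or F G)"

definition simp_Imp :: "'a form \<Rightarrow> 'a form \<Rightarrow> 'a form" where
  "simp_Imp F G =
     (if F = Bot \<or> G = Top then Top else if F = Top then G else Imp F G)"

text \<open>\<open>restr X F\<close> is \<open>F|\<^sub>X\<close>.\<close>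

primrec restr :: "'a set \<Rightarrow> 'a form \<Rightarrow> 'a form" where
  "restr X (Atom a) = (if a \<in> X then Atom a else Bot)"
| "restr X Bot = Bot"
| "restr X (And F G) = simp_And (restr X F) (restr X G)"
| "restr X (Or F G) = simp_Or (restr X F) (restr X G)"
| "restr X (Imp F G) = simp_Imp (restr X F) (restr X G)"

definition FM :: "'a form \<Rightarrow> 'a set \<Rightarrow> 'a lp_module" where
  "FM F Inp =
     (let Out = head (restr (Inp \<union> head F) F)
      in \<lparr>mform = restr (Inp \<union> Out) F, minp = Inp, mout = Out\<rparr>)"

primrec module_P ::
    "('c, 'v) cplus_sig \<Rightarrow> ('c, 'v) law set \<Rightarrow> nat \<Rightarrow> (nat \<times> 'c, 'v) patom lp_module option"
where
  "module_P S D 0 = Some (FM (prog_B S D) {})"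
| "module_P S D (Suc i) =
     Option.bind (module_P S D i) (\<lambda>M. join M (FM (prog_P S D (Suc i)) (mout M)))"

definition module_R ::
    "('c, 'v) cplus_sig \<Rightarrow> ('c, 'v) law set \<Rightarrow> (nat \<Rightarrow> (nat \<times> 'c, 'v) mvatom form) \<Rightarrow> nat
       \<Rightarrow> (nat \<times> 'c, 'v) patom lp_module option"
where
  "module_R S D Q k =
     Option.bind (module_P S D k) (\<lambda>M. join M (FM (prog_Q Q k) (mout M)))"

end

theory Submission
  imports Defs
begin

text \<open>
  Restricting a formula to the outputs of a module does not change the models of its reducts
  among subsets of these outputs, and no atom added to the outputs later occurs in it. Hence
  the stable models of the module are the stable models of all rules together that contain
  only output atoms. A stable model satisfies the body of some rule for each of its atoms,
  and induction on time shows that such atoms survive the restriction and become outputs.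
  Finally, \<open>K\<close> satisfies the multi-valued reduct with respect to \<open>I\<close> iff the atoms on which
  \<open>K\<close> and \<open>I\<close> agree satisfy the propositional one; as every constant has two values, every
  subset of the atoms true in \<open>I\<close> arises in this way.
\<close>

section \<open>Reducts and restriction\<close>

text \<open>This is satisfaction in the logic of here-and-there: \<open>T\<close> is the
  there-world, and the atoms true in both \<open>T'\<close> and \<open>T\<close> form the
  here-world. All stability arguments are phrased through it.\<close>

abbreviation ht :: "('a \<Rightarrow> bool) \<Rightarrow> ('a \<Rightarrow> bool) \<Rightarrow> 'a form \<Rightarrow> bool" where
  "ht T' T F \<equiv> sat T' (reduct T F)"

lemma ht_imp_sat: "ht T' T F \<Longrightarrow> sat T F"
  by (cases F) (auto split: if_splits)

lemma ht_refl: "ht T T F \<longleftrightarrow> sat T F"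
  by (induction F) auto

text \<open>Persistence (\<open>ht_imp_sat\<close>) hides the collapse of false subformulas to
  \<open>Bot\<close>; only an implication must still state its truth in \<open>T\<close> separately.
  From here on these equations replace the recursive definition of \<open>reduct\<close>.\<close>

lemma ht_simps:
  "ht T' T (Atom a) \<longleftrightarrow> T a \<and> T' a"
  "ht T' T Bot \<longleftrightarrow> False"
  "ht T' T (And F G) \<longleftrightarrow> ht T' T F \<and> ht T' T G"
  "ht T' T (Or F G) \<longleftrightarrow> ht T' T F \<or> ht T' T G"
  "ht T' T (Imp F G) \<longleftrightarrow> sat T (Imp F G) \<and> (ht T' T F \<longrightarrow> ht T' T G)"
  by (auto dest: ht_imp_sat)

declare reduct.simps [simp del]
declare ht_simps [simp]

text \<open>The reduct keeps only atoms true in \<open>T\<close>, so \<open>S'\<close> and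
  \<open>T'\<close> have to match only there. The renaming \<open>g\<close> serves the passage to
  propositional atoms and, as the identity, the congruence rule \<open>ht_cong\<close>.\<close>

lemma ht_map_form:
  assumes "\<And>a. a \<in> atoms F \<Longrightarrow> (S (g a) \<longleftrightarrow> T a) \<and> (T a \<longrightarrow> (S' (g a) \<longleftrightarrow> T' a))"
  shows "sat S (map_form g F) \<longleftrightarrow> sat T F" "ht S' S (map_form g F) \<longleftrightarrow> ht T' T F"
  using assms by (induction F) auto

lemma ht_cong:
  assumes "\<And>a. a \<in> atoms F \<Longrightarrow> (S a \<longleftrightarrow> T a) \<and> (T a \<longrightarrow> (S' a \<longleftrightarrow> T' a))"
  shows "ht S' S F \<longleftrightarrow> ht T' T F"
  using ht_map_form(2)[of F S id T S' T'] assms by (simp add: form.map_id)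

lemma sat_cong: "(\<And>a. a \<in> atoms F \<Longrightarrow> S a \<longleftrightarrow> T a) \<Longrightarrow> sat S F \<longleftrightarrow> sat T F"
  by (induction F) auto

text \<open>Such formulas are constraints. By persistence, an antecedent that holds in the reduct
  holds in \<open>T\<close>, so shrinking the here-world cannot violate them.\<close>

lemma ht_headless: "head F = {} \<Longrightarrow> ht T' T F \<longleftrightarrow> sat T F"
  by (induction F) (auto dest: ht_imp_sat)

lemma head_subset_atoms: "head F \<subseteq> atoms F"
  by (induction F) auto

text \<open>The simplification rules are valid in here-and-there, not only classically; hence
  simplifying preserves the models of reducts.\<close>

lemma ht_simp_connectives:
  "ht T' T (simp_And F G) \<longleftrightarrow> ht T' T (And F G)"
  "ht T' T (simp_Or F G) \<longleftrightarrow> ht T' T (Or F G)"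
  "ht T' T (simp_Imp F G) \<longleftrightarrow> ht T' T (Imp F G)"
  by (auto simp: simp_And_def simp_Or_def simp_Imp_def dest: ht_imp_sat)

lemma sat_simp_connectives:
  "sat T (simp_And F G) \<longleftrightarrow> sat T (And F G)"
  "sat T (simp_Or F G) \<longleftrightarrow> sat T (Or F G)"
  "sat T (simp_Imp F G) \<longleftrightarrow> sat T (Imp F G)"
  by (auto simp: simp_And_def simp_Or_def simp_Imp_def)

lemma sat_restr: "sat T (restr X F) \<longleftrightarrow> sat (\<lambda>a. T a \<and> a \<in> X) F"
  by (induction F) (auto simp: sat_simp_connectives)

text \<open>Replacing an atom by \<open>Bot\<close> has the effect of making it false in both
  worlds.\<close>

lemma ht_restr:
  "ht T' T (restr X F) \<longleftrightarrow> ht (\<lambda>a. T' a \<and> a \<in> X) (\<lambda>a. T a \<and> a \<in> X) F"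
  by (induction F) (auto simp: ht_simp_connectives sat_restr)

lemma atoms_restr: "atoms (restr X F) \<subseteq> X \<inter> atoms F"
  by (induction F) (auto simp: simp_And_def simp_Or_def simp_Imp_def)

lemma head_restr: "head (restr X F) \<subseteq> head F"
  by (induction F) (auto simp: simp_And_def simp_Or_def simp_Imp_def)

section \<open>Finite conjunctions and disjunctions, and the unique-value constraints\<close>

lemma set_list_of: "finite A \<Longrightarrow> set (list_of A) = A"
  unfolding list_of_def by (rule someI2_ex[OF finite_distinct_list]) auto

lemma sat_foldr_And: "sat T (foldr And xs Top) \<longleftrightarrow> (\<forall>F\<in>set xs. sat T F)"
  by (induction xs) auto

lemma sat_Conj: "finite A \<Longrightarrow> sat T (Conj A) \<longleftrightarrow> (\<forall>F\<in>A. sat T F)"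
  unfolding Conj_def by (simp add: sat_foldr_And set_list_of)

lemma ht_foldr_And: "ht T' T (foldr And xs Top) \<longleftrightarrow> (\<forall>F\<in>set xs. ht T' T F)"
  by (induction xs) auto

lemma ht_Conj: "finite A \<Longrightarrow> ht T' T (Conj A) \<longleftrightarrow> (\<forall>F\<in>A. ht T' T F)"
  unfolding Conj_def by (simp add: ht_foldr_And set_list_of)

lemma head_foldr_And: "head (foldr And xs Top) = (\<Union>F\<in>set xs. head F)"
  by (induction xs) auto

lemma head_Conj: "finite A \<Longrightarrow> head (Conj A) = (\<Union>F\<in>A. head F)"
  unfolding Conj_def by (simp add: head_foldr_And set_list_of)

lemma atoms_foldr_And: "atoms (foldr And xs Top) = (\<Union>F\<in>set xs. atoms F)"
  by (induction xs) auto

lemma atoms_Conj: "finite A \<Longrightarrow> atoms (Conj A) = (\<Union>F\<in>A. atoms F)"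
  unfolding Conj_def by (simp add: atoms_foldr_And set_list_of)

lemma sat_Disj: "finite A \<Longrightarrow> sat T (Disj A) \<longleftrightarrow> (\<exists>F\<in>A. sat T F)"
proof -
  have "sat T (foldr Or xs Bot) \<longleftrightarrow> (\<exists>F\<in>set xs. sat T F)" for xs
    by (induction xs) auto
  then show "finite A \<Longrightarrow> ?thesis" by (simp add: Disj_def set_list_of)
qed

lemma atoms_Disj: "finite A \<Longrightarrow> atoms (Disj A) = (\<Union>F\<in>A. atoms F)"
proof -
  have "atoms (foldr Or xs Bot) = (\<Union>F\<in>set xs. atoms F)" for xs :: "'a form list"
    by (induction xs) auto
  then show "finite A \<Longrightarrow> ?thesis" by (simp add: Disj_def set_list_of)
qed

text \<open>
  Satisfiability matters here: simplification collapses a conjunction with a conjunct \<open>Bot\<close>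
  and thereby loses all of its heads.
\<close>

lemma head_restr_foldr_And:
  assumes "sat T (restr X (foldr And xs Top))" and "F \<in> set xs"
  shows "head (restr X F) \<subseteq> head (restr X (foldr And xs Top))"
  using assms
proof (induction xs)
  case (Cons G xs)
  let ?C = "restr X (foldr And xs Top)"
  have *: "sat T (restr X G)" "sat T ?C"
    using Cons.prems(1) by (simp_all add: sat_simp_connectives)
  then have "restr X G \<noteq> Bot" "?C \<noteq> Bot" by auto
  then have "head (restr X (foldr And (G # xs) Top)) = head (restr X G) \<union> head ?C"
    by (auto simp: simp_And_def)
  then show ?case using Cons * by auto
qed simp

lemma head_restr_Conj:
  assumes "finite A" and "sat T (restr X (Conj A))" and "F \<in> A"
  shows "head (restr X F) \<subseteq> head (restr X (Conj A))"
  using head_restr_foldr_And[of T X "list_of A" F] assms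
  by (simp add: Conj_def set_list_of)

text \<open>All conjuncts have the head \<open>Bot\<close>, so the formula derives no atom and only
  filters sets of atoms.\<close>

lemma UEC_properties:
  assumes "finite (dm c)"
  shows sat_UEC: "sat T (UEC dm c) \<longleftrightarrow> (\<exists>!v. v \<in> dm c \<and> T (PVal c v))"
    and head_UEC: "head (UEC dm c) = {}"
    and atoms_UEC: "atoms (UEC dm c) \<subseteq> PVal c ` dm c"
proof -
  let ?A = "{Imp (And (Atom (PVal c v)) (Atom (PVal c v'))) Bot | v v'.
        v \<in> dm c \<and> v' \<in> dm c \<and> v \<noteq> v'} \<union>
     {Imp (Neg (Disj {Atom (PVal c v) | v. v \<in> dm c})) Bot}"
  have "?A \<subseteq> (\<lambda>(v, v'). Imp (And (Atom (PVal c v)) (Atom (PVal c v'))) Bot) ` (dm c \<times> dm c)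
    \<union> {Imp (Neg (Disj {Atom (PVal c v) | v. v \<in> dm c})) Bot}" by auto
  then have A: "finite ?A" using assms by (auto intro: finite_subset)
  have D: "finite {Atom (PVal c v) | v. v \<in> dm c}" using assms by auto
  show "sat T (UEC dm c) \<longleftrightarrow> (\<exists>!v. v \<in> dm c \<and> T (PVal c v))"
  proof -
    have "sat T (UEC dm c) \<longleftrightarrow>
        (\<forall>v v'. v \<in> dm c \<and> v' \<in> dm c \<and> v \<noteq> v' \<longrightarrow> \<not> (T (PVal c v) \<and> T (PVal c v'))) \<and>
        (\<exists>F\<in>{Atom (PVal c v) | v. v \<in> dm c}. sat T F)"
      unfolding UEC_def sat_Conj[OF A] ball_Un using sat_Disj[OF D, of T] by fastforce
    also have "(\<exists>F\<in>{Atom (PVal c v) | v. v \<in> dm c}. sat T F) \<longleftrightarrow> (\<exists>v\<in>dm c. T (PVal c v))"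
      by force
    finally show ?thesis by metis
  qed
  show "head (UEC dm c) = {}"
    unfolding UEC_def head_Conj[OF A] by auto
  show "atoms (UEC dm c) \<subseteq> PVal c ` dm c"
    unfolding UEC_def atoms_Conj[OF A] using D by (auto simp: atoms_Disj)
qed

section \<open>Joining a module with an instantiation over its output\<close>

lemma sp_imps_subset: "(G, H) \<in> sp_imps F \<Longrightarrow> atoms G \<subseteq> atoms F \<and> head H \<subseteq> head F"
  by (induction F) auto

text \<open>Bounds the targets of dependency edges: an edge arising from an implication leads to an
  atom of its antecedent.\<close>

lemma nonneg_occ_subset: "nonneg_occ Out pol F \<subseteq> atoms F"
proof (induction F arbitrary: pol)
  case (And F G)
  then show ?case using And.IH(1)[of pol] And.IH(2)[of pol] by auto
next
  case (Or F G)
  then show ?case using Or.IH(1)[of pol] Or.IH(2)[of pol] by auto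
next
  case (Imp F G)
  then show ?case using Imp.IH(1)[of "\<not> pol"] Imp.IH(2)[of pol] by auto
qed simp_all

text \<open>If the representative of a component lies in \<open>A\<close>, closure keeps everything
  reachable from it in \<open>A\<close>. Otherwise no member lies in \<open>A\<close>, because a
  member reaches the representative.\<close>

lemma sccs_closed_split:
  assumes closed: "\<And>p q. (p, q) \<in> E \<Longrightarrow> p \<in> A \<Longrightarrow> q \<in> A" and C: "C \<in> sccs (A \<union> B) E"
  shows "C \<subseteq> A \<or> C \<subseteq> B"
proof -
  have reach: "(p, q) \<in> E\<^sup>* \<Longrightarrow> p \<in> A \<Longrightarrow> q \<in> A" for p q
    by (induction rule: rtrancl_induct) (assumption, rule closed)
  obtain x where x: "C = {(p, q). p \<in> A \<union> B \<and> q \<in> A \<union> B \<and> (p, q) \<in> E\<^sup>* \<and> (q, p) \<in> E\<^sup>*} `` {x}"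
    using C unfolding sccs_def by (rule quotientE)
  have C: "q \<in> C \<Longrightarrow> q \<in> A \<union> B \<and> (x, q) \<in> E\<^sup>* \<and> (q, x) \<in> E\<^sup>*" for q
    unfolding x by (elim ImageE) simp
  show ?thesis
  proof (cases "x \<in> A")
    case True
    then have "C \<subseteq> A" using C reach by fast
    then show ?thesis ..
  next
    case False
    then have "C \<subseteq> B" using C reach by fast
    then show ?thesis ..
  qed
qed

text \<open>
  No dependency leads from the outputs of the first module to those of the second, so no
  strongly connected component meets both.
\<close>

lemma join_FM:
  assumes M: "is_module M" "minp M = {}" and fresh: "head G \<inter> mout M = {}"
  defines "Out \<equiv> head (restr (mout M \<union> head G) G)"
  shows "join M (FM G (mout M)) =
    Some \<lparr>mform = And (mform M) (restr (mout M \<union> Out) G), minp = {}, mout = mout M \<union> Out\<rparr>"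
proof -
  define N where "N = FM G (mout M)"
  define K where "K = restr (mout M \<union> Out) G"
  have N: "mform N = K" "minp N = mout M" "mout N = Out"
    by (simp_all add: N_def K_def FM_def Let_def Out_def)
  have Out: "Out \<subseteq> head G" unfolding Out_def by (rule head_restr)
  have atM: "atoms (mform M) \<subseteq> mout M" using M by (auto simp: is_module_def)
  have atK: "atoms K \<subseteq> mout M \<union> Out" unfolding K_def using atoms_restr[of _ G] by (rule order_trans) simp
  have hdK: "head K \<inter> mout M = {}"
    unfolding K_def using head_restr[of "mout M \<union> Out" G] fresh by blast
  have disj: "mout M \<inter> Out = {}" using Out fresh by blast
  let ?E = "dep_edges (And (mform M) K) (mout M \<union> Out)"
  \<comment> \<open>The heads of \<open>K\<close> avoid \<open>mout M\<close>, so the implication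
    behind the edge comes from \<open>mform M\<close>. Without inputs, all atoms of that formula are
    outputs of \<open>M\<close>.\<close>
  have closed: "q \<in> mout M" if edge: "(p, q) \<in> ?E" and p: "p \<in> mout M" for p q
  proof -
    obtain G' H where GH: "(G', H) \<in> sp_imps (And (mform M) K)" "p \<in> head H"
        "q \<in> nonneg_occ (mout M \<union> Out) True G'"
      using edge unfolding dep_edges_def mem_Collect_eq case_prod_conv by (elim conjE bexE) auto
    have "(G', H) \<notin> sp_imps K"
      using sp_imps_subset[of G' H K] GH(2) hdK p by blast
    then have "atoms G' \<subseteq> atoms (mform M)"
      using GH(1) sp_imps_subset[of G' H "mform M"] by simp
    then show ?thesis using GH(3) nonneg_occ_subset[of _ True G'] atM by (meson subsetD)
  qed
  have "joinable M N"
    unfolding joinable_def N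
  proof (intro conjI ballI)
    show "is_module M" by (rule M)
    show "is_module N" unfolding is_module_def N using atK disj by blast
    show "mout M \<inter> Out = {}" by (rule disj)
    show "C \<subseteq> mout M \<or> C \<subseteq> Out" if "C \<in> sccs (mout M \<union> Out) ?E" for C
      using closed that by (rule sccs_closed_split)
    show "negative_on Out (mform M)"
      unfolding negative_on_def using head_subset_atoms[of "mform M"] atM disj by blast
    show "negative_on (mout M) K" unfolding negative_on_def by (rule hdK)
  qed
  \<comment> \<open>The inputs of the second module are outputs of the first, so the join again has
    no inputs.\<close>
  moreover have "({} \<union> mout M) - (mout M \<union> Out) = {}" by blast
  ultimately have
    "join M N = Some \<lparr>mform = And (mform M) K, minp = {}, mout = mout M \<union> Out\<rparr>"
    by (simp only: join_def N M(2) if_True)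
  then show ?thesis unfolding N_def K_def .
qed

section \<open>The rules added at each step\<close>

text \<open>The slices follow the program: the actions of time \<open>i\<close> enter together with
  the fluents of time \<open>Suc i\<close>. Slicing the theory by step instead of by kind of law
  allows induction on the step.\<close>

primrec new_consts :: "('c, 'v) cplus_sig \<Rightarrow> nat \<Rightarrow> (nat \<times> 'c) set" where
  "new_consts S 0 = {0} \<times> fluents S"
| "new_consts S (Suc i) = {Suc i} \<times> fluents S \<union> {i} \<times> actions S"

primrec new_mv_rules ::
    "('c, 'v) cplus_sig \<Rightarrow> ('c, 'v) law set \<Rightarrow> nat \<Rightarrow> (nat \<times> 'c, 'v) mvatom form set" where
  "new_mv_rules S D 0 =
     {Imp (Neg (Neg (Atom (MVEq (0, c) v)))) (Atom (MVEq (0, c) v)) | c v.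
        c \<in> simple S \<and> v \<in> Dom S c} \<union>
     {Imp (Neg (Neg (stamp 0 G))) (stamp 0 F) | F G. Static F G \<in> D}"
| "new_mv_rules S D (Suc i) =
     {Imp (Neg (Neg (stamp (Suc i) G))) (stamp (Suc i) F) | F G. Static F G \<in> D} \<union>
     {Imp (Neg (Neg (stamp i G))) (stamp i F) | F G. ActionDyn F G \<in> D} \<union>
     {Imp (And (Neg (Neg (stamp (Suc i) G))) (stamp i H)) (stamp (Suc i) F) | F G H.
        FluentDyn F G H \<in> D}"

text \<open>The \<open>UEC\<close> formulas have no multi-valued counterpart; they express that an
  interpretation gives each constant one value.\<close>

definition new_rules ::
    "('c, 'v) cplus_sig \<Rightarrow> ('c, 'v) law set \<Rightarrow> nat \<Rightarrow> (nat \<times> 'c, 'v) patom form set" where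
  "new_rules S D i = UEC (timed_Dom S) ` new_consts S i \<union> prop_form ` new_mv_rules S D i"

lemma prop_form_simps:
  "prop_form (Atom (MVEq c v)) = Atom (PVal c v)"
  "prop_form Bot = Bot"
  "prop_form (And F G) = And (prop_form F) (prop_form G)"
  "prop_form (Imp F G) = Imp (prop_form F) (prop_form G)"
  by (simp_all add: prop_form_def)

lemma image_Collect2: "f ` {g x y | x y. P x y} = {f (g x y) | x y. P x y}"
  and image_Collect3: "f ` {h x y z | x y z. R x y z} = {f (h x y z) | x y z. R x y z}"
  by blast+

text \<open>\<open>Conj\<close> is a function of the set of its members, with an order fixed by
  choice, so equal sets of rules give literally the same formula.\<close>

lemma prog_B_eq: "prog_B S D = Conj (new_rules S D 0)"
proof -
  have "{UEC (timed_Dom S) (0, f) | f. f \<in> fluents S} = UEC (timed_Dom S) ` new_consts S 0"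
    by auto
  then show ?thesis
    unfolding prog_B_def new_rules_def new_mv_rules.simps
      image_Un image_Collect2 prop_form_simps by (simp only: Un_assoc)
qed

lemma prog_P_eq: "prog_P S D (Suc i) = Conj (new_rules S D (Suc i))"
proof -
  have "{UEC (timed_Dom S) (Suc i, f) | f. f \<in> fluents S} \<union>
      {UEC (timed_Dom S) (i, a) | a. a \<in> actions S} = UEC (timed_Dom S) ` new_consts S (Suc i)"
    by auto
  then show ?thesis
    unfolding prog_P_def new_rules_def new_mv_rules.simps diff_Suc_1
      image_Un image_Collect2 image_Collect3 prop_form_simps by (simp only: Un_assoc)
qed

lemma sigma_at_eq: "sigma_at S m = (\<Union>j\<le>m. new_consts S j)"
proof (induction m)
  case 0
  show ?case by (simp add: sigma_at_def)
next
  case (Suc m)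
  have "{0..Suc m} = insert (Suc m) {0..m}" "{0..<Suc m} = insert m {0..<m}" by auto
  then have "sigma_at S (Suc m) = sigma_at S m \<union> new_consts S (Suc m)"
    unfolding sigma_at_def by auto
  then show ?case using Suc by (simp add: atMost_Suc Un_commute)
qed

lemma cplus2mvpf_eq: "cplus2mvpf S D m = (\<Union>j\<le>m. new_mv_rules S D j)"
proof (induction m)
  case 0
  show ?case by (auto simp: cplus2mvpf_def)
next
  case (Suc m)
  \<comment> \<open>Each range gains one index: \<open>Suc m\<close> for static and fluent dynamic
    laws, but \<open>m\<close> for action dynamic laws.\<close>
  have range: "i \<in> {0..Suc m} \<longleftrightarrow> i \<in> {0..m} \<or> i = Suc m"
      "i \<in> {0..<Suc m} \<longleftrightarrow> i \<in> {0..<m} \<or> i = m"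
      "i \<in> {1..Suc m} \<longleftrightarrow> i \<in> {1..m} \<or> i = Suc m" for i
    by auto
  have split: "{f i x y | i x y. P x y \<and> (Q i \<or> i = n)} =
      {f i x y | i x y. P x y \<and> Q i} \<union> {f n x y | x y. P x y}"
    for f :: "nat \<Rightarrow> 'x \<Rightarrow> 'y \<Rightarrow> 'w" and n P Q by blast
  have split3: "{f i x y z | i x y z. P x y z \<and> (Q i \<or> i = n)} =
      {f i x y z | i x y z. P x y z \<and> Q i} \<union> {f n x y z | x y z. P x y z}"
    for f :: "nat \<Rightarrow> 'x \<Rightarrow> 'y \<Rightarrow> 'z \<Rightarrow> 'w" and n P Q by blast
  have "cplus2mvpf S D (Suc m) = cplus2mvpf S D m \<union> new_mv_rules S D (Suc m)"
    unfolding cplus2mvpf_def new_mv_rules.simps range split split3 diff_Suc_1 by (simp only: Un_ac)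
  then show ?case using Suc by (simp add: atMost_Suc Un_commute)
qed

text \<open>A body true in \<open>J\<close> is not simplified to \<open>Bot\<close>, as all atoms of
  \<open>J\<close> are kept, so its rule keeps its head. As \<open>J\<close> also satisfies the
  whole conjunction, this does not collapse either.\<close>

lemma supported_in_head_restr:
  assumes fin: "finite R" and model: "\<forall>f\<in>R. sat (\<lambda>x. x \<in> J) f"
    and sub: "J \<subseteq> X \<union> head (Conj R)"
    and a: "a \<in> J" "Imp b (Atom a) \<in> R" "sat (\<lambda>x. x \<in> J) b"
  shows "a \<in> head (restr (X \<union> head (Conj R)) (Conj R))"
proof -
  let ?Y = "X \<union> head (Conj R)"
  have J: "(\<lambda>x. x \<in> J \<and> x \<in> ?Y) = (\<lambda>x. x \<in> J)" using sub by auto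
  have sat: "sat (\<lambda>x. x \<in> J) (restr ?Y f) \<longleftrightarrow> sat (\<lambda>x. x \<in> J) f" for f
    by (simp only: sat_restr J)
  have "restr ?Y b \<noteq> Bot" using a(3) sat[of b] by (metis sat.simps(2))
  moreover have "a \<in> ?Y" using a(1) sub by blast
  ultimately have "head (restr ?Y (Imp b (Atom a))) = {a}" by (simp add: simp_Imp_def)
  moreover have "sat (\<lambda>x. x \<in> J) (restr ?Y (Conj R))"
    using model by (simp only: sat sat_Conj[OF fin])
  ultimately show ?thesis using head_restr_Conj[OF fin _ a(2)] by blast
qed

lemma ht_restr_subset:
  assumes "J \<subseteq> X" "J' \<subseteq> X"
  shows "ht (\<lambda>x. x \<in> J') (\<lambda>x. x \<in> J) (restr X f) \<longleftrightarrow> ht (\<lambda>x. x \<in> J') (\<lambda>x. x \<in> J) f"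
proof -
  have "(\<lambda>x. x \<in> J \<and> x \<in> X) = (\<lambda>x. x \<in> J)" "(\<lambda>x. x \<in> J' \<and> x \<in> X) = (\<lambda>x. x \<in> J')"
    using assms by auto
  then show ?thesis by (simp only: ht_restr)
qed

section \<open>Well-formed stamped formulas and their levels\<close>

lemma mv_formula_simps:
  "mv_formula \<sigma> dm (Atom (MVEq c v)) \<longleftrightarrow> c \<in> \<sigma> \<and> v \<in> dm c"
  "mv_formula \<sigma> dm Bot"
  "mv_formula \<sigma> dm (And F G) \<longleftrightarrow> mv_formula \<sigma> dm F \<and> mv_formula \<sigma> dm G"
  "mv_formula \<sigma> dm (Imp F G) \<longleftrightarrow> mv_formula \<sigma> dm F \<and> mv_formula \<sigma> dm G"
  by (auto simp: mv_formula_def)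

lemma mv_formula_stamp:
  assumes "cplus_formula S G" and "Pair i ` consts_of G \<subseteq> \<sigma>"
  shows "mv_formula \<sigma> (timed_Dom S) (stamp i G)"
  unfolding mv_formula_def
proof (intro allI impI)
  fix ic v assume "MVEq ic v \<in> atoms (stamp i G)"
  then obtain a where a: "a \<in> atoms G" "MVEq ic v = map_mvatom (Pair i) id a"
    by (auto simp: stamp_def form.set_map)
  obtain c where c: "a = MVEq c v" "ic = (i, c)" using a(2) by (cases a) auto
  then have "c \<in> consts_of G" using a(1) by (auto simp: consts_of_def)
  then show "ic \<in> \<sigma> \<and> v \<in> timed_Dom S ic"
    using a(1) c assms by (auto simp: cplus_formula_def mv_formula_def timed_Dom_def)
qed

lemma consts_of_subset: "cplus_formula S G \<Longrightarrow> consts_of G \<subseteq> constants S"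
  by (auto simp: cplus_formula_def mv_formula_def consts_of_def)

lemma stamp_simps:
  "stamp i Bot = Bot" "stamp i (Atom (MVEq c v)) = Atom (MVEq (i, c) v)"
  by (simp_all add: stamp_def)

text \<open>\<open>sigma_at S i\<close> contains actions only at times below \<open>i\<close>. At
  time \<open>i\<close> itself it contains only fluents, which differ from actions.\<close>

lemma new_consts_fresh: "fluents S \<inter> actions S = {} \<Longrightarrow> new_consts S (Suc i) \<inter> sigma_at S i = {}"
  by (auto simp: sigma_at_def)

lemma sigma_at_mono: "i \<le> j \<Longrightarrow> sigma_at S i \<subseteq> sigma_at S j"
  by (auto simp: sigma_at_def)

lemma sigma_at_fluents: "i \<le> m \<Longrightarrow> Pair i ` fluents S \<subseteq> sigma_at S m"
  and sigma_at_constants: "i < m \<Longrightarrow> Pair i ` constants S \<subseteq> sigma_at S m"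
  by (auto simp: sigma_at_def constants_def)

lemma prop_interp_iff: "PVal c v \<in> prop_interp \<sigma> dm I \<longleftrightarrow> c \<in> \<sigma> \<and> v \<in> dm c \<and> I c = v"
  by (auto simp: prop_interp_def)

section \<open>The rules of a definite action description\<close>

locale definite_description =
  fixes S :: "('c, 'v) cplus_sig" and D :: "('c, 'v) law set"
  assumes description: "action_description S D" and definite: "definite D"
begin

abbreviation level_atoms :: "nat \<Rightarrow> (nat \<times> 'c, 'v) patom set" where
  "level_atoms i \<equiv> prop_atoms (sigma_at S i) (timed_Dom S)"

lemma signature: "cplus_signature S" and finite_laws: "finite D"
  using description by (simp_all add: action_description_def)

lemma finite_constants: "finite (fluents S)" "finite (actions S)" "finite (simple S)"
  using signature by (simp_all add: cplus_signature_def constants_def fluents_def)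

lemma law_wf: "l \<in> D \<Longrightarrow> law_of S l"
  using description by (simp add: action_description_def)

lemma law_head_cases:
  assumes "l \<in> D"
  shows "law_head l = Bot \<or> (\<exists>c v. law_head l = Atom (MVEq c v))"
  using definite assms by (auto simp: definite_def) (metis mvatom.exhaust)

lemma finite_Dom: "c \<in> constants S \<Longrightarrow> finite (Dom S c)"
  using signature by (simp add: cplus_signature_def mv_signature_def)

lemma finite_timed_Dom: "ic \<in> sigma_at S m \<Longrightarrow> finite (timed_Dom S ic)"
  using finite_Dom by (auto simp: sigma_at_def timed_Dom_def constants_def)

lemma finite_new_consts: "finite (new_consts S i)"
  using finite_constants by (cases i) auto

lemma finite_new_mv_rules: "finite (new_mv_rules S D i)"
proof -
  have fin: "finite {f F G | F G. Static F G \<in> D}" "finite {f F G | F G. ActionDyn F G \<in> D}"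
      "finite {g F G H | F G H. FluentDyn F G H \<in> D}"
    for f :: "_ \<Rightarrow> _ \<Rightarrow> (nat \<times> 'c, 'v) mvatom form"
      and g :: "_ \<Rightarrow> _ \<Rightarrow> _ \<Rightarrow> (nat \<times> 'c, 'v) mvatom form"
  proof -
    \<comment> \<open>The value \<open>Bot\<close> is a default for laws of the other kinds; an
      inclusion suffices for finiteness.\<close>
    have "{f F G | F G. Static F G \<in> D} \<subseteq> (\<lambda>l. case l of Static F G \<Rightarrow> f F G | _ \<Rightarrow> Bot) ` D"
      by force
    then show "finite {f F G | F G. Static F G \<in> D}"
      by (rule finite_subset) (rule finite_imageI[OF finite_laws])
    have "{f F G | F G. ActionDyn F G \<in> D} \<subseteq> (\<lambda>l. case l of ActionDyn F G \<Rightarrow> f F G | _ \<Rightarrow> Bot) ` D"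
      by force
    then show "finite {f F G | F G. ActionDyn F G \<in> D}"
      by (rule finite_subset) (rule finite_imageI[OF finite_laws])
    have "{g F G H | F G H. FluentDyn F G H \<in> D} \<subseteq>
        (\<lambda>l. case l of FluentDyn F G H \<Rightarrow> g F G H | _ \<Rightarrow> Bot) ` D"
      by force
    then show "finite {g F G H | F G H. FluentDyn F G H \<in> D}"
      by (rule finite_subset) (rule finite_imageI[OF finite_laws])
  qed
  have "{f c v | c v. c \<in> simple S \<and> v \<in> Dom S c} = (\<lambda>(c, v). f c v) ` (SIGMA c:simple S. Dom S c)"
    for f :: "_ \<Rightarrow> _ \<Rightarrow> (nat \<times> 'c, 'v) mvatom form" by auto
  moreover have "finite (SIGMA c:simple S. Dom S c)"
    using finite_constants finite_Dom by (auto simp: constants_def fluents_def)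
  ultimately show ?thesis
    by (cases i) (simp_all only: new_mv_rules.simps finite_Un fin finite_imageI simp_thms)
qed

lemma finite_new_rules: "finite (new_rules S D i)"
  unfolding new_rules_def using finite_new_consts finite_new_mv_rules by blast

text \<open>Heads are new at each step: this is what makes the outputs of the modules disjoint.\<close>

lemma new_mv_rules_wf:
  assumes "f \<in> new_mv_rules S D i"
  obtains b h where "f = Imp b h" "mv_formula (sigma_at S i) (timed_Dom S) f"
    "h = Bot \<or> (\<exists>ic v. h = Atom (MVEq ic v) \<and> ic \<in> new_consts S i)"
proof -
  note defs = fluent_formula_def action_formula_def
  \<comment> \<open>Definiteness enters here: a stamped head is \<open>Bot\<close> or a single atom,
    whose constant is then located in the slice \<open>N\<close>.\<close>
  have stamp_head: "stamp j F = Bot \<or> (\<exists>ic v. stamp j F = Atom (MVEq ic v) \<and> ic \<in> N)"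
    if "l \<in> D" "F = law_head l" "Pair j ` consts_of F \<subseteq> N" for j F N l
    using law_head_cases[OF that(1)] that(2,3) by (auto simp: stamp_simps consts_of_def)
  have static: "mv_formula (sigma_at S m) (timed_Dom S) (stamp m F)"
      "mv_formula (sigma_at S m) (timed_Dom S) (stamp m G)" "consts_of F \<subseteq> fluents S"
    if "Static F G \<in> D" for F G m
    using law_wf[OF that] sigma_at_fluents[of m m S]
    by (auto simp: defs intro!: mv_formula_stamp)
  \<comment> \<open>A law about actions at time \<open>m\<close> belongs to step
    \<open>Suc m\<close>, the first level whose signature contains these actions.\<close>
  have actdyn: "mv_formula (sigma_at S (Suc m)) (timed_Dom S) (stamp m F)"
      "mv_formula (sigma_at S (Suc m)) (timed_Dom S) (stamp m G)" "consts_of F \<subseteq> actions S"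
    if "ActionDyn F G \<in> D" for F G m
  proof -
    have wf: "cplus_formula S F" "cplus_formula S G" "consts_of F \<inter> fluents S = {}"
      using law_wf[OF that] by (auto simp: defs)
    show "consts_of F \<subseteq> actions S"
      using consts_of_subset[OF wf(1)] wf(3) by (auto simp: constants_def)
    show "mv_formula (sigma_at S (Suc m)) (timed_Dom S) (stamp m F)"
         "mv_formula (sigma_at S (Suc m)) (timed_Dom S) (stamp m G)"
      using wf(1,2)[THEN consts_of_subset] wf(1,2) sigma_at_constants[of m "Suc m" S]
      by (auto intro!: mv_formula_stamp)
  qed
  have fldyn: "mv_formula (sigma_at S (Suc m)) (timed_Dom S) (stamp (Suc m) F)"
      "mv_formula (sigma_at S (Suc m)) (timed_Dom S) (stamp (Suc m) G)"
      "mv_formula (sigma_at S (Suc m)) (timed_Dom S) (stamp m H)" "consts_of F \<subseteq> fluents S"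
    if "FluentDyn F G H \<in> D" for F G H m
  proof -
    have wf: "cplus_formula S F" "cplus_formula S G" "cplus_formula S H"
        "consts_of F \<subseteq> fluents S" "consts_of G \<subseteq> fluents S"
      using law_wf[OF that] by (auto simp: defs)
    show "consts_of F \<subseteq> fluents S" by (rule wf)
    show "mv_formula (sigma_at S (Suc m)) (timed_Dom S) (stamp (Suc m) F)"
      "mv_formula (sigma_at S (Suc m)) (timed_Dom S) (stamp (Suc m) G)"
      using wf sigma_at_fluents[of "Suc m" "Suc m" S] by (auto intro!: mv_formula_stamp)
    \<comment> \<open>The condition after which the law applies may mention actions, and its time
      \<open>m\<close> is strictly below the level.\<close>
    show "mv_formula (sigma_at S (Suc m)) (timed_Dom S) (stamp m H)"
      using wf(3) consts_of_subset[OF wf(3)] sigma_at_constants[of m "Suc m" S]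
      by (auto intro!: mv_formula_stamp)
  qed
  show thesis
  proof (cases i)
    case 0
    from assms[unfolded 0 new_mv_rules.simps] consider
        (simple) c v where "f = Imp (Neg (Neg (Atom (MVEq (0, c) v)))) (Atom (MVEq (0, c) v))"
          "c \<in> simple S" "v \<in> Dom S c"
      | (static) F G where "f = Imp (Neg (Neg (stamp 0 G))) (stamp 0 F)" "Static F G \<in> D"
      by blast
    then show thesis
    proof cases
      case simple
      then show thesis
        by (intro that[of "Neg (Neg (Atom (MVEq (0, c) v)))" "Atom (MVEq (0, c) v)"])
          (auto simp: 0 mv_formula_simps sigma_at_def fluents_def timed_Dom_def)
    next
      case st: static
      show thesis
        using st static(1)[OF st(2), of 0] static(2)[OF st(2), of 0] static(3)[OF st(2)]
          stamp_head[OF st(2), of F 0 "new_consts S i"]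
        by (intro that[of "Neg (Neg (stamp 0 G))" "stamp 0 F"]) (auto simp: 0 mv_formula_simps)
    qed
  next
    case (Suc n)
    from assms[unfolded Suc new_mv_rules.simps] consider
        (static) F G where "f = Imp (Neg (Neg (stamp (Suc n) G))) (stamp (Suc n) F)"
          "Static F G \<in> D"
      | (actdyn) F G where "f = Imp (Neg (Neg (stamp n G))) (stamp n F)" "ActionDyn F G \<in> D"
      | (fldyn) F G H where
          "f = Imp (And (Neg (Neg (stamp (Suc n) G))) (stamp n H)) (stamp (Suc n) F)"
          "FluentDyn F G H \<in> D"
      by blast
    then show thesis
    proof cases
      case st: static
      show thesis
        using st static(1)[OF st(2), of "Suc n"] static(2)[OF st(2), of "Suc n"] static(3)[OF st(2)]
          stamp_head[OF st(2), of F "Suc n" "new_consts S i"]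
        by (intro that[of "Neg (Neg (stamp (Suc n) G))" "stamp (Suc n) F"])
          (auto simp: Suc mv_formula_simps)
    next
      case st: actdyn
      show thesis
        using st actdyn(1)[OF st(2), of n] actdyn(2)[OF st(2), of n] actdyn(3)[OF st(2)]
          stamp_head[OF st(2), of F n "new_consts S i"]
        by (intro that[of "Neg (Neg (stamp n G))" "stamp n F"]) (auto simp: Suc mv_formula_simps)
    next
      case st: fldyn
      show thesis
        using st fldyn(1)[OF st(2), of n] fldyn(2)[OF st(2), of n] fldyn(3)[OF st(2), of n] fldyn(4)[OF st(2)]
          stamp_head[OF st(2), of F "Suc n" "new_consts S i"]
        by (intro that[of "And (Neg (Neg (stamp (Suc n) G))) (stamp n H)" "stamp (Suc n) F"])
          (auto simp: Suc mv_formula_simps)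
    qed
  qed
qed

lemma atoms_prop_form:
  assumes "mv_formula \<sigma> dm f"
  shows "atoms (prop_form f) \<subseteq> prop_atoms \<sigma> dm"
proof
  fix p assume "p \<in> atoms (prop_form f)"
  then obtain a where a: "a \<in> atoms f" "p = patom_of a" by (auto simp: prop_form_def form.set_map)
  obtain c v where "a = MVEq c v" by (cases a)
  then show "p \<in> prop_atoms \<sigma> dm"
    using assms a by (auto simp: mv_formula_def prop_atoms_def)
qed

lemma new_rules_wf:
  assumes "f \<in> new_rules S D i"
  shows atoms_new_rules: "atoms f \<subseteq> level_atoms i"
    and head_new_rules: "head f \<subseteq> {PVal ic v | ic v. ic \<in> new_consts S i}"
proof -
  have "atoms f \<subseteq> level_atoms i \<and> head f \<subseteq> {PVal ic v | ic v. ic \<in> new_consts S i}"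
    using assms unfolding new_rules_def
  proof (elim UnE imageE)
    fix ic assume f: "f = UEC (timed_Dom S) ic" and "ic \<in> new_consts S i"
    then have ic: "ic \<in> sigma_at S i" by (auto simp: sigma_at_eq)
    show ?thesis
      using atoms_UEC[of "timed_Dom S" ic, OF finite_timed_Dom[OF ic]]
       head_UEC[of "timed_Dom S" ic, OF finite_timed_Dom[OF ic]]
       ic
      unfolding f prop_atoms_def by blast
  next
    fix g assume f: "f = prop_form g" and g: "g \<in> new_mv_rules S D i"
    show ?thesis
    proof (rule new_mv_rules_wf[OF g])
      fix b h assume g: "g = Imp b h" "mv_formula (sigma_at S i) (timed_Dom S) g"
        "h = Bot \<or> (\<exists>ic v. h = Atom (MVEq ic v) \<and> ic \<in> new_consts S i)"
      have "head f = head (prop_form h)" by (simp add: f g(1) prop_form_simps)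
      then show ?thesis using atoms_prop_form[OF g(2)] g(3) by (auto simp: f prop_form_simps)
    qed
  qed
  then show "atoms f \<subseteq> level_atoms i" "head f \<subseteq> {PVal ic v | ic v. ic \<in> new_consts S i}"
    by blast+
qed

lemma level_atoms_mono: "i \<le> j \<Longrightarrow> level_atoms i \<subseteq> level_atoms j"
  using sigma_at_mono[of i j S] by (auto simp: prop_atoms_def)

text \<open>Supplies the freshness premise of \<open>join_FM\<close>, since the outputs up to step
  \<open>i\<close> lie in \<open>level_atoms i\<close>.\<close>

lemma head_new_rules_fresh:
  assumes "f \<in> new_rules S D (Suc i)"
  shows "head f \<inter> level_atoms i = {}"
proof -
  have "fluents S \<inter> actions S = {}" using signature by (simp add: cplus_signature_def)
  then show ?thesis
    using head_new_rules[OF assms] new_consts_fresh[of S i] by (fastforce simp: prop_atoms_def)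
qed

section \<open>The modules of the incremental program\<close>

definition rules_up_to :: "nat \<Rightarrow> (nat \<times> 'c, 'v) patom form set" where
  "rules_up_to i = (\<Union>j\<le>i. new_rules S D j)"

text \<open>These are the supported models of the rules, that is, the models of their
  completion.\<close>

definition supported :: "nat \<Rightarrow> (nat \<times> 'c, 'v) patom set \<Rightarrow> bool" where
  "supported i J \<longleftrightarrow> (\<forall>f\<in>rules_up_to i. sat (\<lambda>x. x \<in> J) f) \<and>
     (\<forall>a\<in>J. \<exists>b. Imp b (Atom a) \<in> rules_up_to i \<and> sat (\<lambda>x. x \<in> J) b)"

text \<open>Agreement in here-and-there is strong enough to transfer stability; its case
  \<open>J' = J\<close> gives agreement on models.\<close>

definition represents_rules :: "(nat \<times> 'c, 'v) patom lp_module \<Rightarrow> nat \<Rightarrow> bool" where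
  "represents_rules M i \<longleftrightarrow> (\<forall>J J'. J \<subseteq> mout M \<longrightarrow> J' \<subseteq> mout M \<longrightarrow>
     (ht (\<lambda>x. x \<in> J') (\<lambda>x. x \<in> J) (mform M) \<longleftrightarrow>
      (\<forall>f\<in>rules_up_to i. ht (\<lambda>x. x \<in> J') (\<lambda>x. x \<in> J) f)))"

lemma rules_up_to_simps:
  "rules_up_to 0 = new_rules S D 0"
  "rules_up_to (Suc i) = rules_up_to i \<union> new_rules S D (Suc i)"
  by (auto simp: rules_up_to_def atMost_Suc)

lemma atoms_rules_up_to: "f \<in> rules_up_to i \<Longrightarrow> atoms f \<subseteq> level_atoms i"
  using atoms_new_rules level_atoms_mono unfolding rules_up_to_def by fastforce

text \<open>The invariant of the induction on time. Empty inputs and outputs of bounded level make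
  the next join defined; the last clause says that instantiation cuts off no supported
  model.\<close>

lemma module_P_spec:
  "\<exists>M. module_P S D i = Some M \<and> is_module M \<and> minp M = {} \<and> mout M \<subseteq> level_atoms i \<and>
     represents_rules M i \<and> (\<forall>J. supported i J \<longrightarrow> J \<subseteq> mout M)"
proof (induction i)
  case 0
  let ?C = "Conj (new_rules S D 0)"
  define X where "X = head (restr ({} \<union> head ?C) ?C)"
  define M where "M = \<lparr>mform = restr X ?C, minp = {}, mout = X\<rparr>"
  have "FM ?C {} = M" by (simp only: FM_def Let_def M_def X_def Un_empty_left)
  then have P: "module_P S D 0 = Some M" by (simp only: module_P.simps(1) prog_B_eq)
  have fin: "finite (new_rules S D 0)" by (rule finite_new_rules)
  have at: "atoms ?C \<subseteq> level_atoms 0"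
    unfolding atoms_Conj[OF fin] using atoms_new_rules by (rule UN_least)
  have "X \<subseteq> head ?C" unfolding X_def by (rule head_restr)
  then have "X \<subseteq> level_atoms 0" using head_subset_atoms[of ?C] at by (rule order_trans[OF order_trans])
  moreover have "is_module M"
    using atoms_restr[of X ?C] by (auto simp: is_module_def M_def)
  moreover have "J \<subseteq> X" if supp: "supported 0 J" for J
  proof -
    have J: "\<forall>f\<in>new_rules S D 0. sat (\<lambda>x. x \<in> J) f"
        "\<forall>a\<in>J. \<exists>b. Imp b (Atom a) \<in> new_rules S D 0 \<and> sat (\<lambda>x. x \<in> J) b"
      using supp unfolding supported_def rules_up_to_simps by blast+
    have "J \<subseteq> {} \<union> head ?C"
      unfolding head_Conj[OF fin] using J(2) by force
    from supported_in_head_restr[OF fin J(1) this] J(2) show ?thesis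
      unfolding X_def by blast
  qed
  moreover have "represents_rules M 0"
    unfolding represents_rules_def rules_up_to_simps
    by (simp add: M_def ht_restr_subset ht_Conj[OF fin])
  ultimately show ?case using P by (intro exI[of _ M]) (simp add: M_def)
next
  case (Suc i)
  from Suc.IH obtain M where M: "module_P S D i = Some M" "is_module M" "minp M = {}"
      "mout M \<subseteq> level_atoms i"
    and rep: "represents_rules M i" and supported: "\<And>J. supported i J \<Longrightarrow> J \<subseteq> mout M"
    by blast
  let ?R = "new_rules S D (Suc i)"
  let ?C = "Conj ?R"
  define Out where "Out = head (restr (mout M \<union> head ?C) ?C)"
  define X where "X = mout M \<union> Out"
  define N where "N = \<lparr>mform = And (mform M) (restr X ?C), minp = {}, mout = X\<rparr>"
  have fin: "finite ?R" by (rule finite_new_rules)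
  have fresh: "head ?C \<inter> level_atoms i = {}"
    unfolding head_Conj[OF fin] using head_new_rules_fresh by blast
  have at: "atoms ?C \<subseteq> level_atoms (Suc i)"
    unfolding atoms_Conj[OF fin] using atoms_new_rules by (rule UN_least)
  have "head ?C \<inter> mout M = {}" using fresh M(4) by blast
  from join_FM[OF M(2,3) this] have "join M (FM ?C (mout M)) = Some N"
    by (simp only: N_def X_def Out_def)
  then have P: "module_P S D (Suc i) = Some N"
    by (simp only: module_P.simps(2) M(1) prog_P_eq Option.bind.simps)
  have Out: "Out \<subseteq> head ?C" unfolding Out_def by (rule head_restr)
  have atM: "atoms (mform M) \<subseteq> mout M" using M(2,3) by (simp add: is_module_def)
  \<comment> \<open>Later outputs are heads of new rules and hence new atoms, so earlier levels see
    no outputs beyond those of \<open>M\<close>.\<close>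
  have XM: "X \<inter> level_atoms i = mout M" using Out fresh M(4) unfolding X_def by blast
  have "X \<subseteq> level_atoms (Suc i)"
    using Out at head_subset_atoms[of ?C] M(4) level_atoms_mono[of i "Suc i"]
    unfolding X_def by fastforce
  moreover have "is_module N"
    using atoms_restr[of X ?C] atM unfolding is_module_def N_def by (auto simp: X_def)
  moreover have "J \<subseteq> X" if supp: "supported (Suc i) J" for J
  proof -
    \<comment> \<open>The part of \<open>J\<close> visible to the earlier rules. It is supported by
      them alone, because new rules have no heads at level \<open>i\<close>, so the induction
      hypothesis applies to it.\<close>
    let ?K = "J \<inter> level_atoms i"
    have K: "sat (\<lambda>x. x \<in> ?K) f \<longleftrightarrow> sat (\<lambda>x. x \<in> J) f" if "atoms f \<subseteq> level_atoms i" for f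
      by (rule sat_cong) (use that in blast)
    have model: "\<forall>f\<in>rules_up_to i. sat (\<lambda>x. x \<in> J) f" "\<forall>f\<in>?R. sat (\<lambda>x. x \<in> J) f"
      using supp unfolding supported_def rules_up_to_simps by blast+
    have rule: "\<exists>b. (Imp b (Atom a) \<in> rules_up_to i \<or> Imp b (Atom a) \<in> ?R) \<and> sat (\<lambda>x. x \<in> J) b"
      if "a \<in> J" for a
      using supp that unfolding supported_def rules_up_to_simps by blast
    have "supported i ?K"
      unfolding supported_def
    proof (intro conjI ballI)
      show "sat (\<lambda>x. x \<in> ?K) f" if "f \<in> rules_up_to i" for f
        using model(1) K[OF atoms_rules_up_to[OF that]] that by simp
      fix a assume a: "a \<in> ?K"
      then obtain b where b: "Imp b (Atom a) \<in> rules_up_to i \<or> Imp b (Atom a) \<in> ?R"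
          "sat (\<lambda>x. x \<in> J) b" using rule by blast
      have "Imp b (Atom a) \<notin> ?R" using head_new_rules_fresh[of "Imp b (Atom a)" i] a by auto
      then have in_R: "Imp b (Atom a) \<in> rules_up_to i" using b(1) by simp
      then have "atoms b \<subseteq> level_atoms i" using atoms_rules_up_to[OF in_R] by simp
      then have "sat (\<lambda>x. x \<in> ?K) b" using b(2) K by simp
      then show "\<exists>b. Imp b (Atom a) \<in> rules_up_to i \<and> sat (\<lambda>x. x \<in> ?K) b"
        using in_R by (intro exI[of _ b] conjI)
    qed
    then have K_sub: "?K \<subseteq> mout M" by (rule supported)
    \<comment> \<open>An atom supported by an earlier rule lies in \<open>?K\<close>, hence in the
      old outputs; every other atom of \<open>J\<close> is supported by a new rule.\<close>
    have cases: "a \<in> mout M \<or> (\<exists>b. Imp b (Atom a) \<in> ?R \<and> sat (\<lambda>x. x \<in> J) b)"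
      if a: "a \<in> J" for a
    proof -
      obtain b where b: "Imp b (Atom a) \<in> rules_up_to i \<or> Imp b (Atom a) \<in> ?R"
          "sat (\<lambda>x. x \<in> J) b" using rule a by blast
      from b(1) show ?thesis
      proof
        assume "Imp b (Atom a) \<in> rules_up_to i"
        then have "a \<in> level_atoms i" using atoms_rules_up_to[of "Imp b (Atom a)" i] by simp
        then have "a \<in> mout M" using K_sub a by blast
        then show ?thesis ..
      next
        assume "Imp b (Atom a) \<in> ?R"
        then show ?thesis using b(2) by (intro disjI2 exI[of _ b] conjI)
      qed
    qed
    have J: "J \<subseteq> mout M \<union> head ?C"
    proof
      fix a assume "a \<in> J"
      from cases[OF this] show "a \<in> mout M \<union> head ?C"
        unfolding head_Conj[OF fin] by force
    qed
    show ?thesis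
    proof
      fix a assume a: "a \<in> J"
      from cases[OF a] show "a \<in> X"
        using supported_in_head_restr[OF fin model(2) J a] unfolding X_def Out_def by blast
    qed
  qed
  moreover have "represents_rules N (Suc i)"
    unfolding represents_rules_def
  proof (intro allI impI)
    fix J J' assume "J \<subseteq> mout N" "J' \<subseteq> mout N"
    then have J: "J \<subseteq> X" "J' \<subseteq> X" by (simp_all add: N_def)
    \<comment> \<open>By \<open>XM\<close>, cutting \<open>J\<close> and \<open>J'\<close> down to
      \<open>mout M\<close> changes no atom of level \<open>i\<close>. This reduces the old rules to
      the induction hypothesis.\<close>
    have low: "ht (\<lambda>x. x \<in> J' \<inter> mout M) (\<lambda>x. x \<in> J \<inter> mout M) f \<longleftrightarrow>
        ht (\<lambda>x. x \<in> J') (\<lambda>x. x \<in> J) f" if "atoms f \<subseteq> level_atoms i" for f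
      by (rule ht_cong) (use that J XM in blast)
    have "ht (\<lambda>x. x \<in> J') (\<lambda>x. x \<in> J) (mform M) \<longleftrightarrow>
        ht (\<lambda>x. x \<in> J' \<inter> mout M) (\<lambda>x. x \<in> J \<inter> mout M) (mform M)"
      using low[OF order_trans[OF atM M(4)]] by (rule sym)
    also have "\<dots> \<longleftrightarrow>
        (\<forall>f\<in>rules_up_to i. ht (\<lambda>x. x \<in> J' \<inter> mout M) (\<lambda>x. x \<in> J \<inter> mout M) f)"
      by (rule rep[unfolded represents_rules_def, rule_format]) simp_all
    also have "\<dots> \<longleftrightarrow> (\<forall>f\<in>rules_up_to i. ht (\<lambda>x. x \<in> J') (\<lambda>x. x \<in> J) f)"
      by (rule ball_cong[OF refl low]) (rule atoms_rules_up_to)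
    finally show "ht (\<lambda>x. x \<in> J') (\<lambda>x. x \<in> J) (mform N) \<longleftrightarrow>
        (\<forall>f\<in>rules_up_to (Suc i). ht (\<lambda>x. x \<in> J') (\<lambda>x. x \<in> J) f)"
      unfolding rules_up_to_simps ball_Un
      by (simp only: N_def lp_module.simps ht_simps ht_restr_subset[OF J] ht_Conj[OF fin])
  qed
  ultimately show ?case using P by (intro exI[of _ N]) (simp add: N_def)
qed

text \<open>The query rule is a constraint, so this join adds no outputs. As there are no inputs,
  stability is ordinary minimality among all proper subsets.\<close>

lemma module_R_spec:
  "\<exists>R X. module_R S D F k = Some R \<and>
     (\<forall>J. module_stable R J \<longleftrightarrow> J \<subseteq> X \<and>
        (\<forall>f\<in>rules_up_to k \<union> {prog_Q F k}. sat (\<lambda>x. x \<in> J) f) \<and>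
        \<not> (\<exists>J'. J' \<subset> J \<and> (\<forall>f\<in>rules_up_to k \<union> {prog_Q F k}. ht (\<lambda>x. x \<in> J') (\<lambda>x. x \<in> J) f))) \<and>
     (\<forall>J. supported k J \<longrightarrow> J \<subseteq> X)"
proof -
  obtain M where M: "module_P S D k = Some M" "is_module M" "minp M = {}"
    and rep: "represents_rules M k" and supported: "\<And>J. supported k J \<Longrightarrow> J \<subseteq> mout M"
    using module_P_spec by blast
  let ?Q = "prog_Q F k"
  define X where "X = mout M"
  define R where "R = \<lparr>mform = And (mform M) (restr X ?Q), minp = {}, mout = X\<rparr>"
  have head_Q: "head ?Q = {}" by (simp add: prog_Q_def)
  then have head_restr_Q: "head (restr Y ?Q) = {}" for Y using head_restr[of Y ?Q] by blast
  have "join M (FM ?Q (mout M)) = Some R"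
    using join_FM[OF M(2,3), of ?Q] unfolding head_Q head_restr_Q R_def X_def by simp
  then have R: "module_R S D F k = Some R"
    by (simp only: module_R_def M(1) Option.bind.simps)
  have ht: "ht (\<lambda>x. x \<in> J') (\<lambda>x. x \<in> J) (mform R) \<longleftrightarrow>
      (\<forall>f\<in>rules_up_to k \<union> {?Q}. ht (\<lambda>x. x \<in> J') (\<lambda>x. x \<in> J) f)"
    if J: "J \<subseteq> X" "J' \<subseteq> X" for J J'
    unfolding ball_Un
    using rep[unfolded represents_rules_def, rule_format, OF J[unfolded X_def]]
    by (simp only: R_def lp_module.simps ht_simps ht_restr_subset[OF J] ball_simps simp_thms)
  have sat: "sat (\<lambda>x. x \<in> J) (mform R) \<longleftrightarrow>
      (\<forall>f\<in>rules_up_to k \<union> {?Q}. sat (\<lambda>x. x \<in> J) f)" if J: "J \<subseteq> X" for J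
    using ht[OF J J] by (simp only: ht_refl)
  have stable: "module_stable R J \<longleftrightarrow> J \<subseteq> X \<and>
        (\<forall>f\<in>rules_up_to k \<union> {?Q}. sat (\<lambda>x. x \<in> J) f) \<and>
        \<not> (\<exists>J'. J' \<subset> J \<and> (\<forall>f\<in>rules_up_to k \<union> {?Q}. ht (\<lambda>x. x \<in> J') (\<lambda>x. x \<in> J) f))" for J
  proof (cases "J \<subseteq> X")
    case True
    have mod: "minp R = {}" "mout R = X" by (simp_all add: R_def)
    \<comment> \<open>For \<open>J\<close> within the outputs, the atoms removed are outputs as
      well.\<close>
    have "J' \<subset> J \<and> J - J' \<subseteq> X \<and> ht (\<lambda>x. x \<in> J') (\<lambda>x. x \<in> J) (mform R) \<longleftrightarrow>
        J' \<subset> J \<and> (\<forall>f\<in>rules_up_to k \<union> {?Q}. ht (\<lambda>x. x \<in> J') (\<lambda>x. x \<in> J) f)" for J'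
    proof (cases "J' \<subset> J")
      case sub: True
      then have "J' \<subseteq> X" "J - J' \<subseteq> X" using True by auto
      then show ?thesis using ht[OF True \<open>J' \<subseteq> X\<close>] by simp
    qed simp
    then show ?thesis
      unfolding module_stable_def mod Un_empty_left sat[OF True] by (simp only: True simp_thms)
  next
    case False
    then show ?thesis by (simp add: module_stable_def R_def)
  qed
  show ?thesis
    using R stable supported unfolding X_def[symmetric]
    by (intro exI[of _ R] exI[of _ X] conjI allI impI)
qed

lemma rules_up_to_eq:
  "rules_up_to k = UEC (timed_Dom S) ` sigma_at S k \<union> prop_form ` cplus2mvpf S D k"
  unfolding rules_up_to_def new_rules_def sigma_at_eq cplus2mvpf_eq image_UN by blast

lemma finite_cplus2mvpf: "finite (cplus2mvpf S D k)"
  unfolding cplus2mvpf_eq using finite_new_mv_rules by blast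

lemma cplus2mvpf_wf:
  assumes "f \<in> cplus2mvpf S D k"
  shows "mv_formula (sigma_at S k) (timed_Dom S) f"
    and "\<exists>b h. f = Imp b h \<and> (h = Bot \<or> (\<exists>a. h = Atom a))"
proof -
  from assms obtain j where j: "j \<le> k" "f \<in> new_mv_rules S D j"
    unfolding cplus2mvpf_eq by blast
  from j(2) obtain b h where f: "f = Imp b h" "mv_formula (sigma_at S j) (timed_Dom S) f"
      "h = Bot \<or> (\<exists>ic v. h = Atom (MVEq ic v) \<and> ic \<in> new_consts S j)"
    by (rule new_mv_rules_wf)
  show "mv_formula (sigma_at S k) (timed_Dom S) f"
    using f(2) sigma_at_mono[OF j(1), of S] unfolding mv_formula_def by blast
  show "\<exists>b h. f = Imp b h \<and> (h = Bot \<or> (\<exists>a. h = Atom a))"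
    using f(1,3) by blast
qed

end

section \<open>Multi-valued and propositional stable models\<close>

text \<open>Unique satisfaction splits into existence and uniqueness: \<open>I\<close> satisfies its
  own reduct iff it is a model, by \<open>ht_refl\<close>.\<close>

lemma mv_stable_Conj_iff:
  assumes "finite \<Gamma>"
  shows "mv_stable \<sigma> dm (Conj \<Gamma>) I \<longleftrightarrow> I \<in> mv_interps \<sigma> dm \<and>
    (\<forall>f\<in>\<Gamma>. sat (mv_true I) f) \<and>
    (\<forall>K\<in>mv_interps \<sigma> dm. (\<forall>f\<in>\<Gamma>. ht (mv_true K) (mv_true I) f) \<longrightarrow> K = I)"
proof -
  have "mv_stable \<sigma> dm (Conj \<Gamma>) I \<longleftrightarrow> I \<in> mv_interps \<sigma> dm \<and>
      (\<forall>K\<in>mv_interps \<sigma> dm. (\<forall>f\<in>\<Gamma>. ht (mv_true K) (mv_true I) f) \<longleftrightarrow> K = I)"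
    unfolding mv_stable_def ht_Conj[OF assms] ..
  also have "\<dots> \<longleftrightarrow> I \<in> mv_interps \<sigma> dm \<and>
    (\<forall>f\<in>\<Gamma>. ht (mv_true I) (mv_true I) f) \<and>
    (\<forall>K\<in>mv_interps \<sigma> dm. (\<forall>f\<in>\<Gamma>. ht (mv_true K) (mv_true I) f) \<longrightarrow> K = I)"
    by blast
  finally show ?thesis unfolding ht_refl .
qed

text \<open>The reduct with respect to \<open>I\<close> retains only atoms
  \<open>PVal c (I c)\<close>, so all that counts of \<open>K\<close> is where it agrees with
  \<open>I\<close>.\<close>

lemma ht_prop_form:
  assumes f: "mv_formula \<sigma> dm f"
    and J': "\<And>c. c \<in> \<sigma> \<Longrightarrow> PVal c (I c) \<in> J' \<longleftrightarrow> K c = I c"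
  shows "ht (\<lambda>x. x \<in> J') (\<lambda>x. x \<in> prop_interp \<sigma> dm I) (prop_form f) \<longleftrightarrow>
      ht (mv_true K) (mv_true I) f"
  unfolding prop_form_def
proof (rule ht_map_form(2))
  fix a assume "a \<in> atoms f"
  obtain c v where a: "a = MVEq c v" by (rule mvatom.exhaust)
  then have "c \<in> \<sigma>" "v \<in> dm c" using f \<open>a \<in> atoms f\<close> by (auto simp: mv_formula_def)
  then show "(patom_of a \<in> prop_interp \<sigma> dm I \<longleftrightarrow> mv_true I a) \<and>
      (mv_true I a \<longrightarrow> (patom_of a \<in> J' \<longleftrightarrow> mv_true K a))"
    using J'[of c] by (auto simp: a prop_interp_iff)
qed

lemma sat_prop_form:
  assumes "mv_formula \<sigma> dm f" and "I \<in> mv_interps \<sigma> dm"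
  shows "sat (\<lambda>x. x \<in> prop_interp \<sigma> dm I) (prop_form f) \<longleftrightarrow> sat (mv_true I) f"
proof -
  have "PVal c (I c) \<in> prop_interp \<sigma> dm I \<longleftrightarrow> I c = I c" if "c \<in> \<sigma>" for c
    using that assms(2) by (auto simp: prop_interp_iff mv_interps_def)
  from ht_prop_form[OF assms(1) this] show ?thesis unfolding ht_refl .
qed

text \<open>A second value of each constant permits disagreement at any prescribed set of constants.
  This turns subsets of \<open>prop_interp \<sigma> dm I\<close> into interpretations.\<close>

lemma mv_interps_agree_exactly_on:
  assumes I: "I \<in> mv_interps \<sigma> dm" and two: "\<forall>c\<in>\<sigma>. 2 \<le> card (dm c)"
  shows "\<exists>K\<in>mv_interps \<sigma> dm. \<forall>c\<in>\<sigma>. K c = I c \<longleftrightarrow> c \<in> A"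
proof -
  have "\<exists>v. v \<in> dm c \<and> v \<noteq> I c" if "c \<in> \<sigma>" for c
  proof (rule ccontr)
    assume "\<nexists>v. v \<in> dm c \<and> v \<noteq> I c"
    then have "dm c \<subseteq> {I c}" by blast
    then have "card (dm c) \<le> 1" using card_mono[of "{I c}" "dm c"] by simp
    then show False using two that by fastforce
  qed
  then obtain g where g: "\<And>c. c \<in> \<sigma> \<Longrightarrow> g c \<in> dm c \<and> g c \<noteq> I c" by metis
  define K where "K = (\<lambda>c\<in>\<sigma>. if c \<in> A then I c else g c)"
  have "K \<in> mv_interps \<sigma> dm"
    using I g by (auto simp: K_def mv_interps_def PiE_iff)
  then show ?thesis using g by (intro bexI[of _ K]) (auto simp: K_def)
qed

lemma mv_interps_eqI:
  assumes "I \<in> mv_interps \<sigma> dm" "K \<in> mv_interps \<sigma> dm" "\<And>c. c \<in> \<sigma> \<Longrightarrow> K c = I c"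
  shows "K = I"
  using assms(2,1,3) unfolding mv_interps_def by (rule PiE_ext)

text \<open>
  Changing the value of an unsupported constant preserves the reduct, so in a stable model
  every constant is supported by a rule. This needs a second value.
\<close>

lemma mv_stable_supported:
  assumes I: "I \<in> mv_interps \<sigma> dm" and model: "\<forall>f\<in>\<Gamma>. sat (mv_true I) f"
    and unique: "\<And>K. \<lbrakk>K \<in> mv_interps \<sigma> dm; \<forall>f\<in>\<Gamma>. ht (mv_true K) (mv_true I) f\<rbrakk> \<Longrightarrow> K = I"
    and two: "\<forall>c\<in>\<sigma>. 2 \<le> card (dm c)"
    and shape: "\<And>f. f \<in> \<Gamma> \<Longrightarrow> \<exists>b h. f = Imp b h \<and> (h = Bot \<or> (\<exists>a. h = Atom a))"
    and wf: "\<And>f. f \<in> \<Gamma> \<Longrightarrow> mv_formula \<sigma> dm f"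
    and c: "c \<in> \<sigma>"
  shows "\<exists>b. Imp b (Atom (MVEq c (I c))) \<in> \<Gamma> \<and> sat (mv_true I) b"
proof -
  obtain K where K: "K \<in> mv_interps \<sigma> dm"
      "\<forall>d\<in>\<sigma>. K d = I d \<longleftrightarrow> d \<in> - {c}"
    using mv_interps_agree_exactly_on[OF I two, of "- {c}"] by (rule bexE)
  have iff: "K d = I d \<longleftrightarrow> d \<noteq> c" if "d \<in> \<sigma>" for d
    using bspec[OF K(2) that] by simp
  have "K c \<noteq> I c" using iff[OF c] by simp
  then have "K \<noteq> I" by auto
  then obtain f where f: "f \<in> \<Gamma>" "\<not> ht (mv_true K) (mv_true I) f"
    using unique[OF K(1)] by meson
  obtain b h where bh: "f = Imp b h" "h = Bot \<or> (\<exists>a. h = Atom a)" using shape[OF f(1)] by blast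
  have sat: "sat (mv_true I) (Imp b h)" using bspec[OF model f(1)] unfolding bh(1) .
  \<comment> \<open>The violated rule has a true body and a head that holds in \<open>I\<close> but
    is lost under \<open>K\<close>. Such a head is an atom about a constant where \<open>K\<close>
    and \<open>I\<close> differ, which can only be \<open>c\<close>.\<close>
  then have b: "ht (mv_true K) (mv_true I) b" "\<not> ht (mv_true K) (mv_true I) h"
    using f(2) unfolding bh(1) ht_simps(5) by blast+
  from b(1) have sb: "sat (mv_true I) b" by (rule ht_imp_sat)
  then have sh: "sat (mv_true I) h" using sat by simp
  then obtain a where a: "h = Atom a" using bh(2) by auto
  obtain d v where "a = MVEq d v" by (rule mvatom.exhaust)
  with a sh have h: "h = Atom (MVEq d v)" "I d = v" by simp_all
  have "d \<in> \<sigma>" using wf[OF f(1)] by (simp add: bh(1) h(1) mv_formula_simps)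
  have "K d \<noteq> I d" using b(2) h by simp
  then have "d = c" using iff[OF \<open>d \<in> \<sigma>\<close>] by simp
  then have c_eq: "MVEq c (I c) = MVEq d v" using h(2) by simp
  have "Imp b (Atom (MVEq c (I c))) \<in> \<Gamma>" unfolding c_eq using f(1) bh(1) h(1) by simp
  then show ?thesis using sb by (intro exI[of _ b] conjI)
qed

lemma ht_UEC:
  assumes "finite (dm c)" "c \<in> \<sigma>" "I \<in> mv_interps \<sigma> dm"
  shows "sat (\<lambda>x. x \<in> prop_interp \<sigma> dm I) (UEC dm c)"
    and "ht T' (\<lambda>x. x \<in> prop_interp \<sigma> dm I) (UEC dm c)"
proof -
  have "I c \<in> dm c" using assms(2,3) by (auto simp: mv_interps_def)
  then show "sat (\<lambda>x. x \<in> prop_interp \<sigma> dm I) (UEC dm c)"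
    unfolding sat_UEC[of dm c, OF assms(1)] using assms(2) by (auto simp: prop_interp_iff)
  then show "ht T' (\<lambda>x. x \<in> prop_interp \<sigma> dm I) (UEC dm c)"
    by (simp add: ht_headless head_UEC[of dm c, OF assms(1)])
qed

text \<open>Rivals correspond: \<open>J'\<close> contains \<open>PVal c (I c)\<close> iff
  \<open>K\<close> agrees with \<open>I\<close> at \<open>c\<close>. Proper subsets then match
  interpretations other than \<open>I\<close>, and the \<open>UEC\<close> constraints hold on both
  sides.\<close>

lemma mv_stable_iff_prop_stable:
  assumes fin: "finite \<Gamma>" "\<And>c. c \<in> \<sigma> \<Longrightarrow> finite (dm c)"
    and two: "\<forall>c\<in>\<sigma>. 2 \<le> card (dm c)"
    and wf: "\<And>f. f \<in> \<Gamma> \<Longrightarrow> mv_formula \<sigma> dm f"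
    and I: "I \<in> mv_interps \<sigma> dm"
  defines "J \<equiv> prop_interp \<sigma> dm I" and "prog \<equiv> UEC dm ` \<sigma> \<union> prop_form ` \<Gamma>"
  shows "mv_stable \<sigma> dm (Conj \<Gamma>) I \<longleftrightarrow> (\<forall>f\<in>prog. sat (\<lambda>x. x \<in> J) f) \<and>
    \<not> (\<exists>J'. J' \<subset> J \<and> (\<forall>f\<in>prog. ht (\<lambda>x. x \<in> J') (\<lambda>x. x \<in> J) f))"
proof -
  have sat: "(\<forall>f\<in>prog. sat (\<lambda>x. x \<in> J) f) \<longleftrightarrow> (\<forall>f\<in>\<Gamma>. sat (mv_true I) f)"
    using ht_UEC(1)[OF fin(2) _ I] sat_prop_form[OF wf I]
    by (auto simp: prog_def J_def)
  have ht: "(\<forall>f\<in>prog. ht (\<lambda>x. x \<in> J') (\<lambda>x. x \<in> J) f) \<longleftrightarrow>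
      (\<forall>f\<in>\<Gamma>. ht (mv_true K) (mv_true I) f)"
    if "\<And>c. c \<in> \<sigma> \<Longrightarrow> PVal c (I c) \<in> J' \<longleftrightarrow> K c = I c" for J' K
    using ht_UEC(2)[OF fin(2) _ I] ht_prop_form[OF wf that]
    by (simp add: prog_def J_def ball_Un)
  have Ic: "c \<in> \<sigma> \<Longrightarrow> I c \<in> dm c" for c using I by (auto simp: mv_interps_def)
  have "(\<exists>J'. J' \<subset> J \<and> (\<forall>f\<in>prog. ht (\<lambda>x. x \<in> J') (\<lambda>x. x \<in> J) f)) \<longleftrightarrow>
      (\<exists>K\<in>mv_interps \<sigma> dm. K \<noteq> I \<and> (\<forall>f\<in>\<Gamma>. ht (mv_true K) (mv_true I) f))"
    (is "?L \<longleftrightarrow> ?R")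
  proof
    assume ?L
    then obtain J' where J': "J' \<subset> J" "\<forall>f\<in>prog. ht (\<lambda>x. x \<in> J') (\<lambda>x. x \<in> J) f" by blast
    \<comment> \<open>\<open>K\<close> keeps the value of \<open>I\<close> exactly at the constants
      whose atom survives in \<open>J'\<close>.\<close>
    obtain K where K: "K \<in> mv_interps \<sigma> dm"
      "\<forall>c\<in>\<sigma>. K c = I c \<longleftrightarrow> c \<in> {c. PVal c (I c) \<in> J'}"
      using mv_interps_agree_exactly_on[OF I two, of "{c. PVal c (I c) \<in> J'}"] by (rule bexE)
    have iff: "PVal c (I c) \<in> J' \<longleftrightarrow> K c = I c" if "c \<in> \<sigma>" for c
      using bspec[OF K(2) that] by simp
    obtain p where p: "p \<in> J" "p \<notin> J'" using J'(1) by blast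
    obtain c v where "p = PVal c v" by (rule patom.exhaust)
    then have c: "c \<in> \<sigma>" "PVal c (I c) \<notin> J'" using p by (auto simp: J_def prop_interp_iff)
    have "K c \<noteq> I c" using iff[OF c(1)] c(2) by simp
    then have "K \<noteq> I" by auto
    then show ?R using K(1) ht[OF iff] J'(2) by blast
  next
    assume ?R
    then obtain K where K: "K \<in> mv_interps \<sigma> dm" "K \<noteq> I"
      "\<forall>f\<in>\<Gamma>. ht (mv_true K) (mv_true I) f" by blast
    \<comment> \<open>The atoms on which \<open>K\<close> and \<open>I\<close> agree; the inclusion
      is proper since distinct extensional interpretations differ at some constant of
      \<open>\<sigma>\<close>.\<close>
    define J' where "J' = J \<inter> prop_interp \<sigma> dm K"
    have iff: "PVal c (I c) \<in> J' \<longleftrightarrow> K c = I c" if "c \<in> \<sigma>" for c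
      using that Ic by (auto simp: J'_def J_def prop_interp_iff)
    obtain c where c: "c \<in> \<sigma>" "K c \<noteq> I c" using mv_interps_eqI[OF I K(1)] K(2) by blast
    then have "PVal c (I c) \<in> J - J'" using iff Ic by (simp add: J_def prop_interp_iff)
    then have "J' \<subset> J" by (auto simp: J'_def)
    then show ?L using ht[OF iff] K(3) by blast
  qed
  then show ?thesis
    unfolding mv_stable_Conj_iff[OF fin(1)] sat using I by blast
qed

text \<open>The constraints make the value of each constant definable by a unique description;
  restriction to \<open>\<sigma>\<close> makes the resulting function extensional.\<close>

lemma prop_interp_exists:
  assumes "J \<subseteq> prop_atoms \<sigma> dm" and fin: "\<And>c. c \<in> \<sigma> \<Longrightarrow> finite (dm c)"
    and uec: "\<And>c. c \<in> \<sigma> \<Longrightarrow> sat (\<lambda>x. x \<in> J) (UEC dm c)"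
  shows "\<exists>I\<in>mv_interps \<sigma> dm. J = prop_interp \<sigma> dm I"
proof -
  have ex1: "\<exists>!v. v \<in> dm c \<and> PVal c v \<in> J" if "c \<in> \<sigma>" for c
    using uec[OF that] unfolding sat_UEC[of dm c, OF fin[OF that]] .
  define I where "I = (\<lambda>c\<in>\<sigma>. THE v. v \<in> dm c \<and> PVal c v \<in> J)"
  have I: "I c \<in> dm c \<and> PVal c (I c) \<in> J" if "c \<in> \<sigma>" for c
    using theI'[OF ex1[OF that]] that by (simp add: I_def)
  have "I \<in> mv_interps \<sigma> dm" using I by (auto simp: mv_interps_def I_def)
  moreover have "p \<in> J \<longleftrightarrow> p \<in> prop_interp \<sigma> dm I" for p
  proof -
    obtain c v where p: "p = PVal c v" by (rule patom.exhaust)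
    have "p \<in> J \<longleftrightarrow> c \<in> \<sigma> \<and> v \<in> dm c \<and> PVal c v \<in> J"
      using assms(1) by (auto simp: p prop_atoms_def)
    also have "\<dots> \<longleftrightarrow> c \<in> \<sigma> \<and> v \<in> dm c \<and> I c = v"
      using I ex1 by blast
    finally show ?thesis by (simp add: p prop_interp_iff)
  qed
  ultimately show ?thesis by blast
qed

text \<open>The second value of each constant ensures that stable models are supported. A statically
  determined constant with one value and no rules would have its only interpretation stable,
  although no rule derives its atom.\<close>

theorem theorem2:
  fixes S :: "('c, 'v) cplus_sig"
    and D :: "('c, 'v) law set"
    and F :: "nat \<Rightarrow> (nat \<times> 'c, 'v) mvatom form"
    and k :: nat
  assumes "action_description S D" and "definite D"
    and "mv_formula (sigma_at S k) (timed_Dom S) (F k)"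
    and two_values: "\<forall>c\<in>constants S. 2 \<le> card (Dom S c)"
  defines "\<sigma> \<equiv> sigma_at S k"
    and "dm \<equiv> timed_Dom S"
    and "\<Gamma> \<equiv> Conj (cplus2mvpf S D k \<union> {Imp (Neg (F k)) Bot})"
  shows "\<exists>R. module_R S D F k = Some R \<and>
     (\<forall>I\<in>mv_interps \<sigma> dm. mv_stable \<sigma> dm \<Gamma> I \<longleftrightarrow> module_stable R (prop_interp \<sigma> dm I)) \<and>
     (\<forall>J. J \<subseteq> prop_atoms \<sigma> dm \<longrightarrow>
        (module_stable R J \<longleftrightarrow> (\<exists>I. mv_stable \<sigma> dm \<Gamma> I \<and> J = prop_interp \<sigma> dm I)))"
proof -
  interpret definite_description S D by unfold_locales (use assms(1,2) in auto)
  define G where "G = cplus2mvpf S D k \<union> {Imp (Neg (F k)) Bot}"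
  define P where "P = rules_up_to k \<union> {prog_Q F k}"
  have P: "P = UEC dm ` \<sigma> \<union> prop_form ` G"
    unfolding P_def G_def rules_up_to_eq prog_Q_def dm_def \<sigma>_def
    by (simp only: image_Un image_insert image_empty prop_form_simps Un_assoc)
  have fin_G: "finite G" using finite_cplus2mvpf by (simp add: G_def)
  have fin_dm: "finite (dm c)" if "c \<in> \<sigma>" for c
    using that finite_timed_Dom unfolding dm_def \<sigma>_def by blast
  have two: "\<forall>c\<in>\<sigma>. 2 \<le> card (dm c)"
    using two_values by (auto simp: \<sigma>_def dm_def sigma_at_def timed_Dom_def constants_def)
  have wf: "mv_formula \<sigma> dm f" if "f \<in> G" for f
  proof -
    have "mv_formula \<sigma> dm (Imp (Neg (F k)) Bot)"
      using assms(3) by (simp add: mv_formula_simps \<sigma>_def dm_def)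
    then show ?thesis using that cplus2mvpf_wf(1) unfolding G_def \<sigma>_def dm_def by blast
  qed
  have shape: "\<exists>b h. f = Imp b h \<and> (h = Bot \<or> (\<exists>a. h = Atom a))" if "f \<in> G" for f
    using that cplus2mvpf_wf(2) unfolding G_def by blast
  obtain R X where R: "module_R S D F k = Some R"
    and stable: "\<And>J. module_stable R J \<longleftrightarrow> J \<subseteq> X \<and> (\<forall>f\<in>P. sat (\<lambda>x. x \<in> J) f) \<and>
        \<not> (\<exists>J'. J' \<subset> J \<and> (\<forall>f\<in>P. ht (\<lambda>x. x \<in> J') (\<lambda>x. x \<in> J) f))"
    and supp: "\<And>J. supported k J \<Longrightarrow> J \<subseteq> X"
    using module_R_spec[of F k] unfolding P_def by auto
  have one: "mv_stable \<sigma> dm \<Gamma> I \<longleftrightarrow> module_stable R (prop_interp \<sigma> dm I)"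
    if I: "I \<in> mv_interps \<sigma> dm" for I
  proof -
    let ?J = "prop_interp \<sigma> dm I"
    note iff = mv_stable_iff_prop_stable[of G \<sigma> dm I, OF fin_G fin_dm two wf I, folded P G_def]
    \<comment> \<open>With \<open>iff\<close> at hand, the missing condition for stability in
      \<open>R\<close> is that \<open>?J\<close> consists of outputs. Support supplies it.\<close>
    have "?J \<subseteq> X" if st: "mv_stable \<sigma> dm (Conj G) I"
    proof (rule supp)
      have model: "\<forall>f\<in>G. sat (mv_true I) f"
        and unique: "\<And>K. \<lbrakk>K \<in> mv_interps \<sigma> dm; \<forall>f\<in>G. ht (mv_true K) (mv_true I) f\<rbrakk> \<Longrightarrow> K = I"
        using st unfolding mv_stable_Conj_iff[OF fin_G] by blast+
      show "supported k ?J"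
        unfolding supported_def
      proof (intro conjI ballI)
        fix f assume "f \<in> rules_up_to k"
        then show "sat (\<lambda>x. x \<in> ?J) f" using iff st unfolding P_def by blast
      next
        fix p assume p: "p \<in> ?J"
        obtain c v where "p = PVal c v" by (rule patom.exhaust)
        then have c: "c \<in> \<sigma>" "p = PVal c (I c)" using p by (auto simp: prop_interp_iff)
        obtain b where b: "Imp b (Atom (MVEq c (I c))) \<in> G" "sat (mv_true I) b"
          using mv_stable_supported[OF I model unique two shape wf c(1)] by blast
        \<comment> \<open>The supporting rule cannot be the query constraint, whose head is
          \<open>Bot\<close>.\<close>
        have "Imp b (Atom (MVEq c (I c))) \<in> cplus2mvpf S D k" using b(1) by (simp add: G_def)
        then have "prop_form (Imp b (Atom (MVEq c (I c)))) \<in> rules_up_to k"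
          unfolding rules_up_to_eq by blast
        then have "Imp (prop_form b) (Atom p) \<in> rules_up_to k"
          by (simp only: prop_form_simps c(2))
        moreover have "mv_formula \<sigma> dm b" using wf[OF b(1)] by (simp only: mv_formula_simps)
        then have "sat (\<lambda>x. x \<in> ?J) (prop_form b)"
          using sat_prop_form[OF _ I, of b] b(2) by simp
        ultimately show "\<exists>b. Imp b (Atom p) \<in> rules_up_to k \<and> sat (\<lambda>x. x \<in> ?J) b" by blast
      qed
    qed
    then show ?thesis unfolding stable \<Gamma>_def G_def[symmetric] using iff by blast
  qed
  \<comment> \<open>A stable \<open>J\<close> satisfies every \<open>UEC\<close>, hence comes from
    an interpretation, to which the first part applies.\<close>
  have two: "module_stable R J \<longleftrightarrow> (\<exists>I. mv_stable \<sigma> dm \<Gamma> I \<and> J = prop_interp \<sigma> dm I)"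
    if J: "J \<subseteq> prop_atoms \<sigma> dm" for J
  proof
    assume st: "module_stable R J"
    then have "sat (\<lambda>x. x \<in> J) (UEC dm c)" if "c \<in> \<sigma>" for c
      using that unfolding stable P by blast
    from prop_interp_exists[OF J fin_dm this] obtain I
      where "I \<in> mv_interps \<sigma> dm" "J = prop_interp \<sigma> dm I" by blast
    then show "\<exists>I. mv_stable \<sigma> dm \<Gamma> I \<and> J = prop_interp \<sigma> dm I" using one st by blast
  next
    assume "\<exists>I. mv_stable \<sigma> dm \<Gamma> I \<and> J = prop_interp \<sigma> dm I"
    then show "module_stable R J" using one by (auto simp: mv_stable_def)
  qed
  show ?thesis using R one two by blast
qed

end
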